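(* Let $\mathcal{T}$ be a linear triangulated category generated by an exceptional collection $(E_0,E_1,\ldots,E_n)$. For each $i$ let $\Upsilon_i$ be the (strictly) full extension-closed subcategory of $\mathcal{T}$ generated by the objects $E_i[z]$, $z\in\mathbb{Z}$, and let $\Delta=\{0,1,\ldots,n\}$ with its natural order. Then $(\Delta,\{\Upsilon_i\}_{i\in\Delta})$ is a t-stability on $\mathcal{T}$.
   Context: $\mathcal{T}$ is a triangulated category, linear over a field; "linear" means that for all $X,Y\in\mathcal{T}$ the graded vector space $\bigoplus_j\mathrm{Hom}^j(X,Y)$ is finite dimensional, where $\mathrm{Hom}^j(X,Y)=\mathrm{Hom}_{\mathcal{T}}(X,Y[j])$. An object $E$ is exceptional if $\mathrm{Hom}^{\bullet}(E,E)=\bigoplus_j\mathrm{Hom}^j(E,E)$ is one-dimensional, spanned by the identity. An ordered collection of exceptional objects $(E_0,\ldots,E_n)$ is exceptional if $\mathrm{Hom}^{\bullet}(E_j,E_i)=0$ for all $i<j$. $\mathcal{T}$ is generated by the collection if the smallest full triangulated subcategory containing all finite direct sums $\bigoplus_i V_i^{\bullet}\otimes E_i$ ($V_i^\bullet$ finite-dimensional graded vector spaces, $V^{\bullet}\otimes X=\bigoplus_j V^j\otimes X[-j]$) is $\mathcal{T}$. $\mathrm{Hom}^{\le 0}(\mathcal{X},\mathcal{Y})=0$ means $\mathrm{Hom}^i(X,Y)=0$ for all $i\le 0$, $X\in\mathcal{X}$, $Y\in\mathcal{Y}$. A subcategory $\mathcal{X}$ is extension-closed if for every distinguished triangle $A\to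 B\to C\to A[1]$ with $A,C\in\mathcal{X}$ also $B\in\mathcal{X}$. A t-stability on $\mathcal{T}$ is a pair $(\Phi,\{\Pi_\varphi\}_{\varphi\in\Phi})$, where $\Phi$ is a linearly ordered set and each $\Pi_\varphi\subset\mathcal{T}$ is a nonempty, strictly full (full and closed under isomorphisms), extension-closed subcategory (zero objects are regarded as belonging to every $\Pi_\varphi$), such that: (1) there is an automorphism $\tau$ of the ordered set $\Phi$ with $\Pi_\varphi[1]=\Pi_{\tau(\varphi)}$ and $\tau(\varphi)\ge\varphi$ for all $\varphi$; (2) $\mathrm{Hom}^{\le 0}(\Pi_\psi,\Pi_\varphi)=0$ whenever $\psi>\varphi$; (3) every nonzero $X\in\mathcal{T}$ has a finite system of distinguished triangles $F^{i+1}X\to F^iX\to X_{\varphi_i}\to F^{i+1}X[1]$, $0\le i\le m$, with $F^0X=X$, $F^{m+1}X=0$, $0\ne X_{\varphi_i}\in\Pi_{\varphi_i}$ and $\varphi_0<\varphi_1<\dots<\varphi_m$. *)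

theory Defs
  imports "HOL-Algebra.Module"
begin

section \<open>Linear triangulated categories\<close>

text \<open>
  \<open>Hm C X Y\<close> is the vector space of morphisms from \<open>X\<close> to \<open>Y\<close>; the ring multiplication and
  unit fields that it inherits from the record type \<^type>\<open>module\<close> are never used.  \<open>cmp C g f\<close> is
  the composite of \<open>f\<close> followed by \<open>g\<close>.  Composition and shift do not mention objects, since any
  category can be presented with pairwise disjoint morphism sets; disjointness is not required.
  The shift is a family of functors \<open>X \<mapsto> X[z]\<close>, \<open>z \<in> \<int>\<close>, that is, the powers of
  an automorphism of the category.  An element \<open>(X, Y, Z, f, g, h)\<close> of \<open>dist C\<close> is a distinguished
  triangle \<open>X \<rightarrow> Y \<rightarrow> Z \<rightarrow> X[1]\<close>.
\<close>

record ('o, 'm, 'k) tri_cat =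
  Ob :: "'o set"
  Hm :: "'o \<Rightarrow> 'o \<Rightarrow> ('k, 'm) module"
  ident :: "'o \<Rightarrow> 'm"
  cmp :: "'m \<Rightarrow> 'm \<Rightarrow> 'm"  (infixr "\<cdot>\<index>" 75)
  sh :: "int \<Rightarrow> 'o \<Rightarrow> 'o"
  shm :: "int \<Rightarrow> 'm \<Rightarrow> 'm"
  dist :: "('o \<times> 'o \<times> 'o \<times> 'm \<times> 'm \<times> 'm) set"

definition homs :: "('o, 'm, 'k) tri_cat \<Rightarrow> 'o \<Rightarrow> 'o \<Rightarrow> 'm set" where
  "homs C X Y = carrier (Hm C X Y)"

definition iso_mor :: "('o, 'm, 'k) tri_cat \<Rightarrow> 'o \<Rightarrow> 'o \<Rightarrow> 'm \<Rightarrow> bool" where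
  "iso_mor C X Y f \<longleftrightarrow> f \<in> homs C X Y \<and>
     (\<exists>g\<in>homs C Y X. g \<cdot>\<^bsub>C\<^esub> f = ident C X \<and> f \<cdot>\<^bsub>C\<^esub> g = ident C Y)"

definition isomorphic :: "('o, 'm, 'k) tri_cat \<Rightarrow> 'o \<Rightarrow> 'o \<Rightarrow> bool" where
  "isomorphic C X Y \<longleftrightarrow> (\<exists>f. iso_mor C X Y f)"

definition zero_object :: "('o, 'm, 'k) tri_cat \<Rightarrow> 'o \<Rightarrow> bool" where
  "zero_object C Z \<longleftrightarrow> Z \<in> Ob C \<and>
     (\<forall>X\<in>Ob C. (\<exists>!f. f \<in> homs C Z X) \<and> (\<exists>!f. f \<in> homs C X Z))"

definition direct_sum ::
  "('o, 'm, 'k) tri_cat \<Rightarrow> 'i set \<Rightarrow> ('i \<Rightarrow> 'o) \<Rightarrow> 'o \<Rightarrow> ('i \<Rightarrow> 'm) \<Rightarrow> ('i \<Rightarrow> 'm) \<Rightarrow> bool" where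
  "direct_sum C I X S \<iota> \<pi> \<longleftrightarrow> finite I \<and> S \<in> Ob C \<and>
     (\<forall>i\<in>I. X i \<in> Ob C \<and> \<iota> i \<in> homs C (X i) S \<and> \<pi> i \<in> homs C S (X i)) \<and>
     (\<forall>i\<in>I. \<forall>j\<in>I. \<pi> i \<cdot>\<^bsub>C\<^esub> \<iota> j = (if i = j then ident C (X i) else \<zero>\<^bsub>Hm C (X j) (X i)\<^esub>)) \<and>
     finsum (Hm C S S) (\<lambda>i. \<iota> i \<cdot>\<^bsub>C\<^esub> \<pi> i) I = ident C S"

definition is_direct_sum ::
  "('o, 'm, 'k) tri_cat \<Rightarrow> 'i set \<Rightarrow> ('i \<Rightarrow> 'o) \<Rightarrow> 'o \<Rightarrow> bool" where
  "is_direct_sum C I X S \<longleftrightarrow> (\<exists>\<iota> \<pi>. direct_sum C I X S \<iota> \<pi>)"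

locale linear_category = field K
  for K :: "('k, 'a) ring_scheme" (structure) and C :: "('o, 'm, 'k) tri_cat" +
  assumes Hm_module: "X \<in> Ob C \<Longrightarrow> Y \<in> Ob C \<Longrightarrow> module K (Hm C X Y)"
    and ident_closed: "X \<in> Ob C \<Longrightarrow> ident C X \<in> homs C X X"
    and cmp_closed:
      "\<lbrakk>X \<in> Ob C; Y \<in> Ob C; Z \<in> Ob C; f \<in> homs C X Y; g \<in> homs C Y Z\<rbrakk>
        \<Longrightarrow> g \<cdot>\<^bsub>C\<^esub> f \<in> homs C X Z"
    and cmp_ident_right:
      "\<lbrakk>X \<in> Ob C; Y \<in> Ob C; f \<in> homs C X Y\<rbrakk> \<Longrightarrow> f \<cdot>\<^bsub>C\<^esub> ident C X = f"
    and cmp_ident_left: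
      "\<lbrakk>X \<in> Ob C; Y \<in> Ob C; f \<in> homs C X Y\<rbrakk> \<Longrightarrow> ident C Y \<cdot>\<^bsub>C\<^esub> f = f"
    and cmp_assoc:
      "\<lbrakk>W \<in> Ob C; X \<in> Ob C; Y \<in> Ob C; Z \<in> Ob C;
        f \<in> homs C W X; g \<in> homs C X Y; h \<in> homs C Y Z\<rbrakk>
        \<Longrightarrow> (h \<cdot>\<^bsub>C\<^esub> g) \<cdot>\<^bsub>C\<^esub> f = h \<cdot>\<^bsub>C\<^esub> (g \<cdot>\<^bsub>C\<^esub> f)"
    and cmp_add_right:
      "\<lbrakk>X \<in> Ob C; Y \<in> Ob C; Z \<in> Ob C; f \<in> homs C X Y; f' \<in> homs C X Y; g \<in> homs C Y Z\<rbrakk>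
        \<Longrightarrow> g \<cdot>\<^bsub>C\<^esub> (f \<oplus>\<^bsub>Hm C X Y\<^esub> f') = (g \<cdot>\<^bsub>C\<^esub> f) \<oplus>\<^bsub>Hm C X Z\<^esub> (g \<cdot>\<^bsub>C\<^esub> f')"
    and cmp_add_left:
      "\<lbrakk>X \<in> Ob C; Y \<in> Ob C; Z \<in> Ob C; f \<in> homs C X Y; g \<in> homs C Y Z; g' \<in> homs C Y Z\<rbrakk>
        \<Longrightarrow> (g \<oplus>\<^bsub>Hm C Y Z\<^esub> g') \<cdot>\<^bsub>C\<^esub> f = (g \<cdot>\<^bsub>C\<^esub> f) \<oplus>\<^bsub>Hm C X Z\<^esub> (g' \<cdot>\<^bsub>C\<^esub> f)"
    and cmp_smult_right:
      "\<lbrakk>X \<in> Ob C; Y \<in> Ob C; Z \<in> Ob C; c \<in> carrier K; f \<in> homs C X Y; g \<in> homs C Y Z\<rbrakk>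
        \<Longrightarrow> g \<cdot>\<^bsub>C\<^esub> (c \<odot>\<^bsub>Hm C X Y\<^esub> f) = c \<odot>\<^bsub>Hm C X Z\<^esub> (g \<cdot>\<^bsub>C\<^esub> f)"
    and cmp_smult_left:
      "\<lbrakk>X \<in> Ob C; Y \<in> Ob C; Z \<in> Ob C; c \<in> carrier K; f \<in> homs C X Y; g \<in> homs C Y Z\<rbrakk>
        \<Longrightarrow> (c \<odot>\<^bsub>Hm C Y Z\<^esub> g) \<cdot>\<^bsub>C\<^esub> f = c \<odot>\<^bsub>Hm C X Z\<^esub> (g \<cdot>\<^bsub>C\<^esub> f)"
    and zero_object_exists: "\<exists>Z. zero_object C Z"
    and direct_sum_exists:
      "\<lbrakk>X \<in> Ob C; Y \<in> Ob C\<rbrakk> \<Longrightarrow> \<exists>S. is_direct_sum C UNIV (\<lambda>b. if b then X else Y) S"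

locale linear_category_with_shift = linear_category +
  assumes sh_closed: "X \<in> Ob C \<Longrightarrow> sh C z X \<in> Ob C"
    and sh_zero: "X \<in> Ob C \<Longrightarrow> sh C 0 X = X"
    and sh_add: "X \<in> Ob C \<Longrightarrow> sh C (y + z) X = sh C y (sh C z X)"
    and shm_closed:
      "\<lbrakk>X \<in> Ob C; Y \<in> Ob C; f \<in> homs C X Y\<rbrakk> \<Longrightarrow> shm C z f \<in> homs C (sh C z X) (sh C z Y)"
    and shm_zero: "\<lbrakk>X \<in> Ob C; Y \<in> Ob C; f \<in> homs C X Y\<rbrakk> \<Longrightarrow> shm C 0 f = f"
    and shm_add:
      "\<lbrakk>X \<in> Ob C; Y \<in> Ob C; f \<in> homs C X Y\<rbrakk> \<Longrightarrow> shm C (y + z) f = shm C y (shm C z f)"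
    and shm_ident: "X \<in> Ob C \<Longrightarrow> shm C z (ident C X) = ident C (sh C z X)"
    and shm_cmp:
      "\<lbrakk>X \<in> Ob C; Y \<in> Ob C; Z \<in> Ob C; f \<in> homs C X Y; g \<in> homs C Y Z\<rbrakk>
        \<Longrightarrow> shm C z (g \<cdot>\<^bsub>C\<^esub> f) = shm C z g \<cdot>\<^bsub>C\<^esub> shm C z f"
    and shm_plus:
      "\<lbrakk>X \<in> Ob C; Y \<in> Ob C; f \<in> homs C X Y; g \<in> homs C X Y\<rbrakk>
        \<Longrightarrow> shm C z (f \<oplus>\<^bsub>Hm C X Y\<^esub> g) = shm C z f \<oplus>\<^bsub>Hm C (sh C z X) (sh C z Y)\<^esub> shm C z g"
    and shm_smult:
      "\<lbrakk>X \<in> Ob C; Y \<in> Ob C; c \<in> carrier K; f \<in> homs C X Y\<rbrakk>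
        \<Longrightarrow> shm C z (c \<odot>\<^bsub>Hm C X Y\<^esub> f) = c \<odot>\<^bsub>Hm C (sh C z X) (sh C z Y)\<^esub> shm C z f"

definition triangle ::
  "('o, 'm, 'k) tri_cat \<Rightarrow> 'o \<times> 'o \<times> 'o \<times> 'm \<times> 'm \<times> 'm \<Rightarrow> bool" where
  "triangle C = (\<lambda>(X, Y, Z, f, g, h). X \<in> Ob C \<and> Y \<in> Ob C \<and> Z \<in> Ob C \<and>
     f \<in> homs C X Y \<and> g \<in> homs C Y Z \<and> h \<in> homs C Z (sh C 1 X))"

locale triangulated_category = linear_category_with_shift +
  assumes dist_triangle: "t \<in> dist C \<Longrightarrow> triangle C t"
    and TR1_iso:
      "\<lbrakk>(X, Y, Z, f, g, h) \<in> dist C; triangle C (X', Y', Z', f', g', h');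
        iso_mor C X X' a; iso_mor C Y Y' b; iso_mor C Z Z' c;
        b \<cdot>\<^bsub>C\<^esub> f = f' \<cdot>\<^bsub>C\<^esub> a; c \<cdot>\<^bsub>C\<^esub> g = g' \<cdot>\<^bsub>C\<^esub> b; shm C 1 a \<cdot>\<^bsub>C\<^esub> h = h' \<cdot>\<^bsub>C\<^esub> c\<rbrakk>
        \<Longrightarrow> (X', Y', Z', f', g', h') \<in> dist C"
    and TR1_ident:
      "\<lbrakk>X \<in> Ob C; zero_object C Z\<rbrakk>
        \<Longrightarrow> (X, X, Z, ident C X, \<zero>\<^bsub>Hm C X Z\<^esub>, \<zero>\<^bsub>Hm C Z (sh C 1 X)\<^esub>) \<in> dist C"
    and TR1_cone:
      "\<lbrakk>X \<in> Ob C; Y \<in> Ob C; f \<in> homs C X Y\<rbrakk> \<Longrightarrow> \<exists>Z g h. (X, Y, Z, f, g, h) \<in> dist C"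
    and TR2:
      "triangle C (X, Y, Z, f, g, h) \<Longrightarrow>
        (X, Y, Z, f, g, h) \<in> dist C \<longleftrightarrow>
        (Y, Z, sh C 1 X, g, h, \<ominus>\<^bsub>Hm C (sh C 1 X) (sh C 1 Y)\<^esub> (shm C 1 f)) \<in> dist C"
    and TR3:
      "\<lbrakk>(X, Y, Z, f, g, h) \<in> dist C; (X', Y', Z', f', g', h') \<in> dist C;
        a \<in> homs C X X'; b \<in> homs C Y Y'; b \<cdot>\<^bsub>C\<^esub> f = f' \<cdot>\<^bsub>C\<^esub> a\<rbrakk>
        \<Longrightarrow> \<exists>c\<in>homs C Z Z'. c \<cdot>\<^bsub>C\<^esub> g = g' \<cdot>\<^bsub>C\<^esub> b \<and> shm C 1 a \<cdot>\<^bsub>C\<^esub> h = h' \<cdot>\<^bsub>C\<^esub> c"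
    and TR4:
      "\<lbrakk>(X, Y, A, f, p, d) \<in> dist C; (Y, Z, B, g, q, e) \<in> dist C;
        (X, Z, D, g \<cdot>\<^bsub>C\<^esub> f, r, s) \<in> dist C\<rbrakk>
        \<Longrightarrow> \<exists>u\<in>homs C A D. \<exists>v\<in>homs C D B.
              (A, D, B, u, v, shm C 1 p \<cdot>\<^bsub>C\<^esub> e) \<in> dist C \<and>
              u \<cdot>\<^bsub>C\<^esub> p = r \<cdot>\<^bsub>C\<^esub> g \<and> s \<cdot>\<^bsub>C\<^esub> u = d \<and>
              v \<cdot>\<^bsub>C\<^esub> r = q \<and> e \<cdot>\<^bsub>C\<^esub> v = shm C 1 f \<cdot>\<^bsub>C\<^esub> s"

text \<open>
  The graded vector space \<open>\<Oplus>\<^sub>j Hom(X, Y[j])\<close>, realised as finitely supported families.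
\<close>

definition graded_hom :: "('o, 'm, 'k) tri_cat \<Rightarrow> 'o \<Rightarrow> 'o \<Rightarrow> ('k, int \<Rightarrow> 'm) module" where
  "graded_hom C X Y =
     \<lparr> carrier = {f. (\<forall>j. f j \<in> homs C X (sh C j Y)) \<and>
                     finite {j. f j \<noteq> \<zero>\<^bsub>Hm C X (sh C j Y)\<^esub>}},
       monoid.mult = undefined,
       one = undefined,
       zero = (\<lambda>j. \<zero>\<^bsub>Hm C X (sh C j Y)\<^esub>),
       add = (\<lambda>f g j. f j \<oplus>\<^bsub>Hm C X (sh C j Y)\<^esub> g j),
       smult = (\<lambda>c f j. c \<odot>\<^bsub>Hm C X (sh C j Y)\<^esub> f j) \<rparr>"

definition finite_dim :: "('k, 'a) ring_scheme \<Rightarrow> ('k, 'v) module \<Rightarrow> bool" where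
  "finite_dim K V \<longleftrightarrow> (\<exists>B. finite B \<and> B \<subseteq> carrier V \<and>
     (\<forall>v\<in>carrier V. \<exists>c\<in>B \<rightarrow> carrier K. v = finsum V (\<lambda>b. c b \<odot>\<^bsub>V\<^esub> b) B))"

locale linear_triangulated_category = triangulated_category +
  assumes graded_hom_finite_dim:
    "\<lbrakk>X \<in> Ob C; Y \<in> Ob C\<rbrakk> \<Longrightarrow> finite_dim K (graded_hom C X Y)"


section \<open>Subcategories\<close>

text \<open>Full subcategories are represented by their sets of objects.\<close>

definition strictly_full :: "('o, 'm, 'k) tri_cat \<Rightarrow> 'o set \<Rightarrow> bool" where
  "strictly_full C S \<longleftrightarrow> S \<subseteq> Ob C \<and> (\<forall>X\<in>S. \<forall>Y\<in>Ob C. isomorphic C X Y \<longrightarrow> Y \<in> S)"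

definition extension_closed :: "('o, 'm, 'k) tri_cat \<Rightarrow> 'o set \<Rightarrow> bool" where
  "extension_closed C S \<longleftrightarrow>
     (\<forall>X Y Z f g h. (X, Y, Z, f, g, h) \<in> dist C \<longrightarrow> X \<in> S \<longrightarrow> Z \<in> S \<longrightarrow> Y \<in> S)"

definition extension_closure :: "('o, 'm, 'k) tri_cat \<Rightarrow> 'o set \<Rightarrow> 'o set" where
  "extension_closure C A = \<Inter> {S. strictly_full C S \<and> extension_closed C S \<and> A \<subseteq> S}"

text \<open>
  Together with the closure under shifts and the rotation of triangles, closure under cones says
  that if two of the objects of a distinguished triangle lie in \<open>S\<close>, so does the third.
\<close>

definition triangulated_subcategory :: "('o, 'm, 'k) tri_cat \<Rightarrow> 'o set \<Rightarrow> bool" where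
  "triangulated_subcategory C S \<longleftrightarrow> strictly_full C S \<and> S \<noteq> {} \<and>
     (\<forall>X\<in>S. \<forall>z. sh C z X \<in> S) \<and>
     (\<forall>X Y Z f g h. (X, Y, Z, f, g, h) \<in> dist C \<longrightarrow> X \<in> S \<longrightarrow> Y \<in> S \<longrightarrow> Z \<in> S)"

definition triangulated_hull :: "('o, 'm, 'k) tri_cat \<Rightarrow> 'o set \<Rightarrow> 'o set" where
  "triangulated_hull C A = \<Inter> {S. triangulated_subcategory C S \<and> A \<subseteq> S}"


section \<open>Exceptional collections\<close>

definition exceptional :: "('k, 'a) ring_scheme \<Rightarrow> ('o, 'm, 'k) tri_cat \<Rightarrow> 'o \<Rightarrow> bool" where
  "exceptional K C E \<longleftrightarrow> E \<in> Ob C \<and>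
     (let e = (\<lambda>j. if j = 0 then ident C E else \<zero>\<^bsub>Hm C E (sh C j E)\<^esub>)
      in e \<noteq> \<zero>\<^bsub>graded_hom C E E\<^esub> \<and>
         carrier (graded_hom C E E) = {c \<odot>\<^bsub>graded_hom C E E\<^esub> e | c. c \<in> carrier K})"

definition exceptional_collection ::
  "('k, 'a) ring_scheme \<Rightarrow> ('o, 'm, 'k) tri_cat \<Rightarrow> nat \<Rightarrow> (nat \<Rightarrow> 'o) \<Rightarrow> bool" where
  "exceptional_collection K C n E \<longleftrightarrow> (\<forall>i\<le>n. exceptional K C (E i)) \<and>
     (\<forall>i j. i < j \<longrightarrow> j \<le> n \<longrightarrow>
        carrier (graded_hom C (E j) (E i)) = {\<zero>\<^bsub>graded_hom C (E j) (E i)\<^esub>})"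

text \<open>
  A finite-dimensional graded vector space \<open>V\<close> is given up to isomorphism by its dimensions
  \<open>d j = dim V\<^sup>j\<close>, and \<open>V\<^sup>j \<otimes> X[-j]\<close> is the direct sum of \<open>d j\<close> copies of \<open>X[-j]\<close>; so
  \<open>graded_tensor C d X W\<close> says that \<open>W\<close> is a choice of \<open>V \<otimes> X\<close>.
\<close>

definition graded_tensor :: "('o, 'm, 'k) tri_cat \<Rightarrow> (int \<Rightarrow> nat) \<Rightarrow> 'o \<Rightarrow> 'o \<Rightarrow> bool" where
  "graded_tensor C d X W \<longleftrightarrow>
     is_direct_sum C (SIGMA j:{j. d j \<noteq> 0}. {..<d j}) (\<lambda>(j, l). sh C (- j) X) W"

definition graded_sums ::
  "('o, 'm, 'k) tri_cat \<Rightarrow> nat \<Rightarrow> (nat \<Rightarrow> 'o) \<Rightarrow> 'o set" where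
  "graded_sums C n E = {S. \<exists>d W.
     (\<forall>i\<le>n. finite {j. d i j \<noteq> 0} \<and> graded_tensor C (d i) (E i) (W i)) \<and>
     is_direct_sum C {..n} W S}"

definition generated_by :: "('o, 'm, 'k) tri_cat \<Rightarrow> nat \<Rightarrow> (nat \<Rightarrow> 'o) \<Rightarrow> bool" where
  "generated_by C n E \<longleftrightarrow> triangulated_hull C (graded_sums C n E) = Ob C"


section \<open>t-stabilities\<close>

definition hom_nonpos_zero :: "('o, 'm, 'k) tri_cat \<Rightarrow> 'o set \<Rightarrow> 'o set \<Rightarrow> bool" where
  "hom_nonpos_zero C S T \<longleftrightarrow>
     (\<forall>X\<in>S. \<forall>Y\<in>T. \<forall>i\<le>0. homs C X (sh C i Y) = {\<zero>\<^bsub>Hm C X (sh C i Y)\<^esub>})"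

text \<open>
  The system of triangles \<open>F\<^sup>i\<^sup>+\<^sup>1X \<rightarrow> F\<^sup>iX \<rightarrow> X\<^sub>i\<close> of slope \<open>\<phi> i\<close>, \<open>0 \<le> i \<le> m\<close>; the last term
  \<open>F\<^sup>m\<^sup>+\<^sup>1X\<close> may be any zero object.
\<close>

definition filtration ::
  "('o, 'm, 'k) tri_cat \<Rightarrow> 'p::linorder set \<Rightarrow> ('p \<Rightarrow> 'o set) \<Rightarrow> 'o \<Rightarrow> nat \<Rightarrow>
   (nat \<Rightarrow> 'o) \<Rightarrow> (nat \<Rightarrow> 'o) \<Rightarrow> (nat \<Rightarrow> 'p) \<Rightarrow> bool" where
  "filtration C \<Phi> P X m F Q \<phi> \<longleftrightarrow>
     F 0 = X \<and> zero_object C (F (Suc m)) \<and>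
     (\<forall>i\<le>m. (\<exists>f g h. (F (Suc i), F i, Q i, f, g, h) \<in> dist C) \<and>
            \<phi> i \<in> \<Phi> \<and> Q i \<in> P (\<phi> i) \<and> \<not> zero_object C (Q i)) \<and>
     (\<forall>i<m. \<phi> i < \<phi> (Suc i))"

definition t_stability ::
  "('o, 'm, 'k) tri_cat \<Rightarrow> 'p::linorder set \<Rightarrow> ('p \<Rightarrow> 'o set) \<Rightarrow> bool" where
  "t_stability C \<Phi> P \<longleftrightarrow>
     (\<forall>\<phi>\<in>\<Phi>. P \<phi> \<noteq> {} \<and> strictly_full C (P \<phi>) \<and> extension_closed C (P \<phi>) \<and>
            (\<forall>Z. zero_object C Z \<longrightarrow> Z \<in> P \<phi>)) \<and>
     (\<exists>\<tau>. bij_betw \<tau> \<Phi> \<Phi> \<and> strict_mono_on \<Phi> \<tau> \<and>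
          (\<forall>\<phi>\<in>\<Phi>. sh C 1 ` P \<phi> = P (\<tau> \<phi>) \<and> \<phi> \<le> \<tau> \<phi>)) \<and>
     (\<forall>\<phi>\<in>\<Phi>. \<forall>\<psi>\<in>\<Phi>. \<phi> < \<psi> \<longrightarrow> hom_nonpos_zero C (P \<psi>) (P \<phi>)) \<and>
     (\<forall>X\<in>Ob C. \<not> zero_object C X \<longrightarrow> (\<exists>m F Q \<phi>. filtration C \<Phi> P X m F Q \<phi>))"

end

theory Submission
  imports Defs
begin

text \<open>
  Write \<open>\<Upsilon>\<^sub>i\<close> for the extension closure of the shifts of \<open>E\<^sub>i\<close>, and \<open>A * B\<close> for the class
  \<open>extensions C A B\<close> of all \<open>Y\<close> in a triangle \<open>X \<rightarrow> Y \<rightarrow> Z \<rightarrow> X[1]\<close> with \<open>X \<in> A\<close> and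
  \<open>Z \<in> B\<close>.  Each \<open>\<Upsilon>\<^sub>i\<close> is stable under extensions and shifts, and therefore under cones: the
  cone \<open>Z\<close> of \<open>X \<rightarrow> Y\<close> is an extension of \<open>X[1]\<close> by \<open>Y\<close>.  So each \<open>\<Upsilon>\<^sub>i\<close> is a triangulated
  subcategory.  The vanishing of \<open>Hom(E\<^sub>j, E\<^sub>i[z])\<close> for \<open>i < j\<close> passes to \<open>\<Upsilon>\<^sub>j\<close> and
  \<open>\<Upsilon>\<^sub>i\<close>, because the objects orthogonal to a fixed object are closed under extensions
  (\<open>extension_closure_orthogonal\<close>).  Since \<open>\<Upsilon>\<^sub>i[1] = \<Upsilon>\<^sub>i\<close>, the
  automorphism of the index set is the identity, and only the filtrations remain to be constructed.

  They come from the equality \<open>Ob C = \<Upsilon>\<^sub>n * (\<Upsilon>\<^sub>n\<^sub>-\<^sub>1 * (\<dots> * \<Upsilon>\<^sub>0))\<close>; the octahedral axiom makes the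
  bracketing irrelevant, and the brackets that give the filtration directly are those of
  \<open>layers\<close>, which peels off \<open>\<Upsilon>\<^sub>0\<close> first.  The heart of the matter is
  \<open>extensions_triangulated\<close>: if \<open>A\<close> and \<open>B\<close> are triangulated and there are no morphisms from
  \<open>A\<close> to \<open>B\<close>, then \<open>A * B\<close> is triangulated.  Indeed every triangle with first term in \<open>B\<close> and
  third term in \<open>A\<close> has zero connecting morphism and splits, so \<open>B * A \<subseteq> A * B\<close>, and
  \<open>(A * B) * (A * B) \<subseteq> A * (B * A) * B \<subseteq> A * (A * B) * B \<subseteq> A * B\<close>.
  By induction the iterated product is triangulated.  It contains every \<open>E\<^sub>i[z]\<close>, hence, by
  \<open>triangulated_direct_sum\<close>, all finite direct sums of these objects, hence every object, as the
  collection generates the category.  The layers of an object that vanish can be omitted from its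
  filtration, again since the iterated product of the remaining \<open>\<Upsilon>\<^sub>i\<close> is closed under extensions.
\<close>

section \<open>Zero morphisms and zero objects\<close>

context linear_category
begin

abbreviation null where
  "null X Y \<equiv> \<zero>\<^bsub>Hm C X Y\<^esub>"

lemma Hm_group:
  assumes "X \<in> Ob C" "Y \<in> Ob C"
  shows "abelian_group (Hm C X Y)"
  using Hm_module[OF assms] by (simp add: module_def)

lemma null_closed: "X \<in> Ob C \<Longrightarrow> Y \<in> Ob C \<Longrightarrow> null X Y \<in> homs C X Y"
  unfolding homs_def by (rule abelian_monoid.zero_closed[OF abelian_group.axioms(1)[OF Hm_group]])

lemma minus_closed:
  "X \<in> Ob C \<Longrightarrow> Y \<in> Ob C \<Longrightarrow> f \<in> homs C X Y \<Longrightarrow> \<ominus>\<^bsub>Hm C X Y\<^esub> f \<in> homs C X Y"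
  unfolding homs_def by (rule abelian_group.a_inv_closed[OF Hm_group])

lemma minus_minus_mor:
  "X \<in> Ob C \<Longrightarrow> Y \<in> Ob C \<Longrightarrow> f \<in> homs C X Y \<Longrightarrow> \<ominus>\<^bsub>Hm C X Y\<^esub> (\<ominus>\<^bsub>Hm C X Y\<^esub> f) = f"
  unfolding homs_def by (rule abelian_group.minus_minus[OF Hm_group])

lemma minus_null:
  assumes "X \<in> Ob C" "Y \<in> Ob C"
  shows "\<ominus>\<^bsub>Hm C X Y\<^esub> (null X Y) = null X Y"
proof -
  interpret abelian_group "Hm C X Y" using Hm_group assms by simp
  show ?thesis using minus_equality[of "null X Y" "null X Y"] by simp
qed

lemma minus_eq_nullD:
  assumes "X \<in> Ob C" "Y \<in> Ob C" "f \<in> homs C X Y" "\<ominus>\<^bsub>Hm C X Y\<^esub> f = null X Y"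
  shows "f = null X Y"
  using assms minus_minus_mor minus_null by metis

lemma idempotent_null:
  assumes "X \<in> Ob C" "Y \<in> Ob C" "f \<in> homs C X Y" "f \<oplus>\<^bsub>Hm C X Y\<^esub> f = f"
  shows "f = null X Y"
proof -
  interpret abelian_group "Hm C X Y" using Hm_group assms by simp
  show ?thesis using assms(3,4) add.r_cancel_one[of f f] by (simp add: homs_def)
qed

lemma null_add_null:
  assumes "X \<in> Ob C" "Y \<in> Ob C"
  shows "null X Y \<oplus>\<^bsub>Hm C X Y\<^esub> null X Y = null X Y"
proof -
  interpret abelian_group "Hm C X Y" using Hm_group assms by simp
  show ?thesis by simp
qed

lemma cmp_null_right:
  assumes "X \<in> Ob C" "Y \<in> Ob C" "Z \<in> Ob C" "g \<in> homs C Y Z"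
  shows "g \<cdot>\<^bsub>C\<^esub> null X Y = null X Z"
proof (rule idempotent_null)
  show "g \<cdot>\<^bsub>C\<^esub> null X Y \<oplus>\<^bsub>Hm C X Z\<^esub> g \<cdot>\<^bsub>C\<^esub> null X Y = g \<cdot>\<^bsub>C\<^esub> null X Y"
    using cmp_add_right[OF assms(1-3) null_closed null_closed assms(4)] assms null_add_null by simp
qed (use assms null_closed cmp_closed in blast)+

lemma cmp_null_left:
  assumes "X \<in> Ob C" "Y \<in> Ob C" "Z \<in> Ob C" "f \<in> homs C X Y"
  shows "null Y Z \<cdot>\<^bsub>C\<^esub> f = null X Z"
proof (rule idempotent_null)
  show "null Y Z \<cdot>\<^bsub>C\<^esub> f \<oplus>\<^bsub>Hm C X Z\<^esub> null Y Z \<cdot>\<^bsub>C\<^esub> f = null Y Z \<cdot>\<^bsub>C\<^esub> f"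
    using cmp_add_left[OF assms(1-4) null_closed null_closed] assms null_add_null by simp
qed (use assms null_closed cmp_closed in blast)+

lemma cmp_minus_right:
  assumes "X \<in> Ob C" "Y \<in> Ob C" "Z \<in> Ob C" "f \<in> homs C X Y" "g \<in> homs C Y Z"
  shows "g \<cdot>\<^bsub>C\<^esub> (\<ominus>\<^bsub>Hm C X Y\<^esub> f) = \<ominus>\<^bsub>Hm C X Z\<^esub> (g \<cdot>\<^bsub>C\<^esub> f)"
proof -
  interpret XY: abelian_group "Hm C X Y" using Hm_group assms by simp
  interpret XZ: abelian_group "Hm C X Z" using Hm_group assms by simp
  have "g \<cdot>\<^bsub>C\<^esub> (\<ominus>\<^bsub>Hm C X Y\<^esub> f) \<oplus>\<^bsub>Hm C X Z\<^esub> g \<cdot>\<^bsub>C\<^esub> f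
      = g \<cdot>\<^bsub>C\<^esub> (\<ominus>\<^bsub>Hm C X Y\<^esub> f \<oplus>\<^bsub>Hm C X Y\<^esub> f)"
    using assms by (simp add: cmp_add_right minus_closed)
  also have "\<dots> = null X Z"
    using assms XY.l_neg by (simp add: cmp_null_right homs_def)
  finally show ?thesis
    using XZ.minus_equality cmp_closed[OF assms]
      cmp_closed[OF assms(1-3) minus_closed[OF assms(1,2,4)] assms(5)] by (simp add: homs_def)
qed

lemma cmp_minus_left:
  assumes "X \<in> Ob C" "Y \<in> Ob C" "Z \<in> Ob C" "f \<in> homs C X Y" "g \<in> homs C Y Z"
  shows "(\<ominus>\<^bsub>Hm C Y Z\<^esub> g) \<cdot>\<^bsub>C\<^esub> f = \<ominus>\<^bsub>Hm C X Z\<^esub> (g \<cdot>\<^bsub>C\<^esub> f)"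
proof -
  interpret YZ: abelian_group "Hm C Y Z" using Hm_group assms by simp
  interpret XZ: abelian_group "Hm C X Z" using Hm_group assms by simp
  have "(\<ominus>\<^bsub>Hm C Y Z\<^esub> g) \<cdot>\<^bsub>C\<^esub> f \<oplus>\<^bsub>Hm C X Z\<^esub> g \<cdot>\<^bsub>C\<^esub> f
      = (\<ominus>\<^bsub>Hm C Y Z\<^esub> g \<oplus>\<^bsub>Hm C Y Z\<^esub> g) \<cdot>\<^bsub>C\<^esub> f"
    using assms by (simp add: cmp_add_left minus_closed)
  also have "\<dots> = null X Z"
    using assms YZ.l_neg by (simp add: cmp_null_left homs_def)
  finally show ?thesis
    using XZ.minus_equality cmp_closed[OF assms]
      cmp_closed[OF assms(1-4) minus_closed[OF assms(2,3,5)]] by (simp add: homs_def)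
qed

text \<open>
  This is all that is used of the sum in the definition of a direct sum: a morphism that kills every
  \<open>\<iota>\<^sub>i \<pi>\<^sub>i\<close> kills the identity.
\<close>

lemma cmp_finsum_null:
  assumes "finite I" "S \<in> Ob C" "W \<in> Ob C" "u \<in> homs C S W"
    and "\<And>i. i \<in> I \<Longrightarrow> s i \<in> homs C S S" "\<And>i. i \<in> I \<Longrightarrow> u \<cdot>\<^bsub>C\<^esub> s i = null S W"
  shows "u \<cdot>\<^bsub>C\<^esub> finsum (Hm C S S) s I = null S W"
proof -
  interpret abelian_group "Hm C S S" using Hm_group assms by simp
  show ?thesis using assms(1,5,6)
  proof (induction I)
    case empty
    then show ?case using assms by (simp add: cmp_null_right)
  next
    case (insert i I)
    have s: "s \<in> I \<rightarrow> carrier (Hm C S S)" using insert.prems by (auto simp: homs_def)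
    have "finsum (Hm C S S) s I \<in> homs C S S"
      unfolding homs_def by (rule finsum_closed[OF s])
    then show ?case
      using insert assms s
      by (simp add: finsum_insert cmp_add_right null_add_null flip: homs_def)
  qed
qed

lemma zero_objectD: "zero_object C Z \<Longrightarrow> Z \<in> Ob C"
  by (simp add: zero_object_def)

lemma from_zero_object:
  "zero_object C Z \<Longrightarrow> X \<in> Ob C \<Longrightarrow> f \<in> homs C Z X \<Longrightarrow> f = null Z X"
  unfolding zero_object_def using null_closed by blast

lemma to_zero_object:
  "zero_object C Z \<Longrightarrow> X \<in> Ob C \<Longrightarrow> f \<in> homs C X Z \<Longrightarrow> f = null X Z"
  unfolding zero_object_def using null_closed by blast

lemma zero_object_iff_ident:
  "zero_object C Z \<longleftrightarrow> Z \<in> Ob C \<and> ident C Z = null Z Z"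
proof
  assume "zero_object C Z"
  then show "Z \<in> Ob C \<and> ident C Z = null Z Z"
    using from_zero_object ident_closed zero_objectD by blast
next
  assume Z: "Z \<in> Ob C \<and> ident C Z = null Z Z"
  have "f = null Z X" if "X \<in> Ob C" "f \<in> homs C Z X" for f X
    using that Z cmp_ident_right cmp_null_right by metis
  moreover have "f = null X Z" if "X \<in> Ob C" "f \<in> homs C X Z" for f X
    using that Z cmp_ident_left cmp_null_left by metis
  ultimately show "zero_object C Z"
    unfolding zero_object_def using Z null_closed by blast
qed

end

context linear_category_with_shift
begin

lemma shm_null:
  assumes "X \<in> Ob C" "Y \<in> Ob C"
  shows "shm C z (null X Y) = null (sh C z X) (sh C z Y)"
proof (rule idempotent_null)
  show "shm C z (null X Y) \<oplus>\<^bsub>Hm C (sh C z X) (sh C z Y)\<^esub> shm C z (null X Y) = shm C z (null X Y)"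
    using shm_plus[OF assms null_closed null_closed] assms null_add_null by simp
qed (use assms null_closed sh_closed shm_closed in blast)+

lemma zero_object_sh: "zero_object C Z \<Longrightarrow> zero_object C (sh C z Z)"
  by (metis zero_object_iff_ident shm_ident shm_null sh_closed)

lemma sh_uminus: "X \<in> Ob C \<Longrightarrow> sh C z (sh C (- z) X) = X" "X \<in> Ob C \<Longrightarrow> sh C (- z) (sh C z X) = X"
  using sh_add[of X z "- z"] sh_add[of X "- z" z] sh_zero by auto

lemma shm_uminus:
  "X \<in> Ob C \<Longrightarrow> Y \<in> Ob C \<Longrightarrow> f \<in> homs C X Y \<Longrightarrow> shm C z (shm C (- z) f) = f"
  "X \<in> Ob C \<Longrightarrow> Y \<in> Ob C \<Longrightarrow> f \<in> homs C X Y \<Longrightarrow> shm C (- z) (shm C z f) = f"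
  using shm_add[of X Y f z "- z"] shm_add[of X Y f "- z" z] shm_zero by auto

end

section \<open>Rotation and exactness\<close>

text \<open>
  Most arguments concern the existence of a triangle on three objects and not its morphisms; this
  predicate also hides the signs that rotation introduces.
\<close>

definition has_triangle :: "('o, 'm, 'k) tri_cat \<Rightarrow> 'o \<Rightarrow> 'o \<Rightarrow> 'o \<Rightarrow> bool" where
  "has_triangle C X Y Z \<longleftrightarrow> (\<exists>f g h. (X, Y, Z, f, g, h) \<in> dist C)"

definition orthogonal :: "('o, 'm, 'k) tri_cat \<Rightarrow> 'o \<Rightarrow> 'o \<Rightarrow> bool" where
  "orthogonal C X Y \<longleftrightarrow> (\<forall>z. homs C X (sh C z Y) = {\<zero>\<^bsub>Hm C X (sh C z Y)\<^esub>})"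

context triangulated_category
begin

lemma distD:
  assumes "(X, Y, Z, f, g, h) \<in> dist C"
  shows "X \<in> Ob C" "Y \<in> Ob C" "Z \<in> Ob C"
    "f \<in> homs C X Y" "g \<in> homs C Y Z" "h \<in> homs C Z (sh C 1 X)"
  using dist_triangle[OF assms] by (auto simp: triangle_def)

lemma has_triangleD:
  assumes "has_triangle C X Y Z"
  shows "X \<in> Ob C" "Y \<in> Ob C" "Z \<in> Ob C"
  using assms distD unfolding has_triangle_def by blast+

lemma rotate:
  "(X, Y, Z, f, g, h) \<in> dist C \<Longrightarrow>
    (Y, Z, sh C 1 X, g, h, \<ominus>\<^bsub>Hm C (sh C 1 X) (sh C 1 Y)\<^esub> (shm C 1 f)) \<in> dist C"
  using TR2 dist_triangle by blast

text \<open>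
  The morphism \<open>Z[-1] \<rightarrow> X\<close> must carry a sign because the rotation axiom negates it once more.
\<close>

lemma rotate_back:
  assumes t: "(X, Y, Z, f, g, h) \<in> dist C"
  shows "(sh C (- 1) Z, X, Y, shm C (- 1) (\<ominus>\<^bsub>Hm C Z (sh C 1 X)\<^esub> h), f, g) \<in> dist C"
proof -
  note D = distD[OF t]
  have h: "\<ominus>\<^bsub>Hm C Z (sh C 1 X)\<^esub> h \<in> homs C Z (sh C 1 X)"
    using D minus_closed sh_closed by blast
  have "shm C (- 1) (\<ominus>\<^bsub>Hm C Z (sh C 1 X)\<^esub> h) \<in> homs C (sh C (- 1) Z) X"
    using shm_closed[OF _ _ h, of "- 1"] D sh_closed sh_uminus(2)[of X 1] by simp
  then have tri: "triangle C (sh C (- 1) Z, X, Y, shm C (- 1) (\<ominus>\<^bsub>Hm C Z (sh C 1 X)\<^esub> h), f, g)"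
    using D sh_closed sh_uminus(1)[of Z 1] by (simp add: triangle_def)
  show ?thesis
    unfolding TR2[OF tri]
    using t D h minus_minus_mor sh_closed shm_uminus(1)[OF _ _ h, of 1] sh_uminus(1)[of Z 1]
    by simp
qed

lemma has_triangle_rotate: "has_triangle C X Y Z \<Longrightarrow> has_triangle C Y Z (sh C 1 X)"
  unfolding has_triangle_def using rotate by blast

lemma has_triangle_rotate_back: "has_triangle C X Y Z \<Longrightarrow> has_triangle C (sh C (- 1) Z) X Y"
  unfolding has_triangle_def using rotate_back by blast

text \<open>
  Three rotations shift a triangle by one, up to signs on its morphisms.
\<close>

lemma has_triangle_sh:
  assumes "has_triangle C X Y Z"
  shows "has_triangle C (sh C z X) (sh C z Y) (sh C z Z)"
proof (induction z rule: int_induct[where k = 0])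
  case base
  show ?case using assms has_triangleD[OF assms] sh_zero by simp
next
  case (step1 i)
  have "sh C (i + 1) W = sh C 1 (sh C i W)" if "W \<in> Ob C" for W
    using sh_add[OF that, of 1 i] by (simp add: add.commute)
  then show ?case
    using step1.IH has_triangleD[OF assms] has_triangle_rotate by metis
next
  case (step2 i)
  have "sh C (i - 1) W = sh C (- 1) (sh C i W)" if "W \<in> Ob C" for W
    using sh_add[OF that, of "- 1" i] by simp
  then show ?case
    using step2.IH has_triangleD[OF assms] has_triangle_rotate_back by metis
qed

lemma dist_null_ident:
  assumes Z: "zero_object C Z" and W: "W \<in> Ob C"
  shows "(Z, W, W, null Z W, ident C W, null W (sh C 1 Z)) \<in> dist C"
proof -
  have "triangle C (Z, W, W, null Z W, ident C W, null W (sh C 1 Z))"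
    using assms zero_objectD ident_closed null_closed sh_closed by (simp add: triangle_def)
  from TR2[OF this] show ?thesis
    using TR1_ident[OF W zero_object_sh[OF Z, of 1]] zero_objectD[OF Z] W sh_closed
    by (simp add: shm_null minus_null)
qed

text \<open>
  The third axiom, applied to the pair of morphisms \<open>id\<close> and \<open>f\<close> from the triangle
  \<open>X \<rightarrow> X \<rightarrow> 0\<close>, factors \<open>g f\<close> through a zero object.
\<close>

lemma dist_cmp_null:
  assumes t: "(X, Y, Z, f, g, h) \<in> dist C"
  shows "g \<cdot>\<^bsub>C\<^esub> f = null X Z"
proof -
  obtain U where U: "zero_object C U" using zero_object_exists by blast
  note D = distD[OF t] zero_objectD[OF U]
  obtain c where "c \<in> homs C U Z" "c \<cdot>\<^bsub>C\<^esub> null X U = g \<cdot>\<^bsub>C\<^esub> f"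
    using TR3[OF TR1_ident[OF D(1) U] t ident_closed[OF D(1)] D(4)] by blast
  then show ?thesis using D cmp_null_right by metis
qed

text \<open>
  Exactness of \<open>Hom(_, W)\<close> at \<open>Y\<close>: the factorisation is the third component of a morphism to
  the triangle \<open>0 \<rightarrow> W \<rightarrow> W\<close>.
\<close>

lemma factor_through_cone:
  assumes t: "(X, Y, Z, f, g, h) \<in> dist C"
    and W: "W \<in> Ob C" and u: "u \<in> homs C Y W" and uf: "u \<cdot>\<^bsub>C\<^esub> f = null X W"
  obtains v where "v \<in> homs C Z W" "v \<cdot>\<^bsub>C\<^esub> g = u"
proof -
  obtain U where U: "zero_object C U" using zero_object_exists by blast
  note D = distD[OF t] zero_objectD[OF U]
  have "u \<cdot>\<^bsub>C\<^esub> f = null U W \<cdot>\<^bsub>C\<^esub> null X U"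
    using uf D W by (simp add: cmp_null_right null_closed)
  from TR3[OF t dist_null_ident[OF U W] null_closed[OF D(1) D(7)] u this]
  obtain v where "v \<in> homs C Z W" "v \<cdot>\<^bsub>C\<^esub> g = ident C W \<cdot>\<^bsub>C\<^esub> u" by blast
  then show ?thesis using that cmp_ident_left D W u by metis
qed

text \<open>
  Exactness of \<open>Hom(W, _)\<close> at \<open>Y\<close>.  The third axiom only completes the first two components of
  a morphism of triangles, so both triangles are rotated once, from \<open>W \<rightarrow> W \<rightarrow> 0\<close> to
  \<open>W \<rightarrow> 0 \<rightarrow> W[1]\<close>; the completion is then the shift of the required lift.
\<close>

lemma lift_through_fibre:
  assumes t: "(X, Y, Z, f, g, h) \<in> dist C"
    and W: "W \<in> Ob C" and u: "u \<in> homs C W Y" and gu: "g \<cdot>\<^bsub>C\<^esub> u = null W Z"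
  obtains v where "v \<in> homs C W X" "f \<cdot>\<^bsub>C\<^esub> v = u"
proof -
  obtain U where U: "zero_object C U" using zero_object_exists by blast
  note D = distD[OF t] zero_objectD[OF U]
  let ?W = "sh C 1 W" and ?X = "sh C 1 X" and ?Y = "sh C 1 Y"
  have S: "?W \<in> Ob C" "?X \<in> Ob C" "?Y \<in> Ob C" using D W sh_closed by auto
  have u1: "shm C 1 u \<in> homs C ?W ?Y" and f1: "shm C 1 f \<in> homs C ?X ?Y"
    using D W u shm_closed by auto
  have eq: "null U Z \<cdot>\<^bsub>C\<^esub> null W U = g \<cdot>\<^bsub>C\<^esub> u"
    using gu D W by (simp add: cmp_null_right null_closed)
  from TR3[OF rotate[OF TR1_ident[OF W U]] rotate[OF t] u null_closed[OF D(7) D(3)] eq]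
  obtain c where c: "c \<in> homs C ?W ?X"
    and "shm C 1 u \<cdot>\<^bsub>C\<^esub> (\<ominus>\<^bsub>Hm C ?W ?W\<^esub> (shm C 1 (ident C W)))
       = (\<ominus>\<^bsub>Hm C ?X ?Y\<^esub> (shm C 1 f)) \<cdot>\<^bsub>C\<^esub> c" by blast
  then have "\<ominus>\<^bsub>Hm C ?W ?Y\<^esub> (shm C 1 u) = \<ominus>\<^bsub>Hm C ?W ?Y\<^esub> (shm C 1 f \<cdot>\<^bsub>C\<^esub> c)"
    using S W u1 f1
    by (simp add: shm_ident cmp_minus_right cmp_minus_left ident_closed cmp_ident_right)
  then have uc: "shm C 1 u = shm C 1 f \<cdot>\<^bsub>C\<^esub> c"
    using minus_minus_mor S u1 f1 c cmp_closed by metis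
  have c': "shm C (- 1) c \<in> homs C W X"
    using shm_closed[OF S(1,2) c, of "- 1"] sh_uminus(2)[of _ 1] D W by simp
  have "f \<cdot>\<^bsub>C\<^esub> shm C (- 1) c = shm C (- 1) (shm C 1 f \<cdot>\<^bsub>C\<^esub> c)"
    using shm_cmp[OF S c f1, of "- 1"] shm_uminus(2)[of X Y f 1] D by simp
  also have "\<dots> = u" using uc shm_uminus(2)[of W Y u 1] D W u by simp
  finally show ?thesis using that c' by blast
qed

lemma has_triangle_zero_left: "zero_object C Z \<Longrightarrow> X \<in> Ob C \<Longrightarrow> has_triangle C Z X X"
  unfolding has_triangle_def using dist_null_ident by blast

text \<open>
  Through this lemma a class that contains the zero objects and is closed under extensions is
  automatically closed under isomorphisms.
\<close>

lemma has_triangle_iso: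
  assumes "isomorphic C X Y" "X \<in> Ob C" "Y \<in> Ob C" "zero_object C Z"
  shows "has_triangle C X Y Z"
proof -
  obtain b where b: "iso_mor C X Y b" using assms(1) unfolding isomorphic_def by blast
  have b': "b \<in> homs C X Y" using b by (simp add: iso_mor_def)
  have id: "iso_mor C W W (ident C W)" if "W \<in> Ob C" for W
    unfolding iso_mor_def using that ident_closed cmp_ident_left by metis
  have Z: "Z \<in> Ob C" using assms zero_objectD by blast
  note ob = assms(2,3) Z sh_closed[OF assms(2), of 1]
  have "(X, Y, Z, b, null Y Z, null Z (sh C 1 X)) \<in> dist C"
    by (rule TR1_iso[OF TR1_ident[OF assms(2,4)] _ id b id])
      (use ob b' in \<open>simp_all add: triangle_def null_closed shm_ident cmp_ident_left
         cmp_ident_right cmp_null_left cmp_null_right ident_closed\<close>)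
  then show ?thesis unfolding has_triangle_def by blast
qed

lemma orthogonal_iff:
  assumes "X \<in> Ob C" "Y \<in> Ob C"
  shows "orthogonal C X Y \<longleftrightarrow> (\<forall>z. \<forall>f\<in>homs C X (sh C z Y). f = null X (sh C z Y))"
  unfolding orthogonal_def using null_closed assms sh_closed by blast

lemma orthogonal_sh_left:
  assumes "orthogonal C X Y" "X \<in> Ob C" "Y \<in> Ob C"
  shows "orthogonal C (sh C w X) Y"
proof -
  have "f = null (sh C w X) (sh C z Y)" if f: "f \<in> homs C (sh C w X) (sh C z Y)" for f z
  proof -
    have "shm C (- w) f \<in> homs C X (sh C (z - w) Y)"
      using shm_closed[OF _ _ f, of "- w"] sh_add[of Y "- w" z] assms sh_closed sh_uminus(2) by simp
    then have "shm C (- w) f = null X (sh C (z - w) Y)"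
      using assms by (simp add: orthogonal_def)
    then have "shm C w (shm C (- w) f) = null (sh C w X) (sh C w (sh C (z - w) Y))"
      using assms sh_closed by (simp add: shm_null)
    moreover have "sh C w (sh C (z - w) Y) = sh C z Y"
      using sh_add[of Y w "z - w"] assms by simp
    ultimately show ?thesis
      using shm_uminus(1)[OF _ _ f, of w] assms sh_closed by simp
  qed
  then show ?thesis using orthogonal_iff assms sh_closed by simp
qed

lemma orthogonal_sh_right:
  assumes "orthogonal C X Y" "Y \<in> Ob C"
  shows "orthogonal C X (sh C w Y)"
  using assms unfolding orthogonal_def by (simp flip: sh_add)

lemma orthogonal_zero_left: "zero_object C Z \<Longrightarrow> X \<in> Ob C \<Longrightarrow> orthogonal C Z X"
  using orthogonal_iff from_zero_object zero_objectD sh_closed by meson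

lemma orthogonal_zero_right: "zero_object C Z \<Longrightarrow> X \<in> Ob C \<Longrightarrow> orthogonal C X Z"
  using orthogonal_iff to_zero_object zero_objectD zero_object_sh by meson

lemma orthogonal_extension_left:
  assumes "has_triangle C X Y Z" "orthogonal C X W" "orthogonal C Z W" "W \<in> Ob C"
  shows "orthogonal C Y W"
proof -
  obtain f g h where t: "(X, Y, Z, f, g, h) \<in> dist C" using assms has_triangle_def by metis
  note D = distD[OF t]
  have "u = null Y (sh C z W)" if u: "u \<in> homs C Y (sh C z W)" for u z
  proof -
    have Wz: "sh C z W \<in> Ob C" using assms sh_closed by blast
    have "u \<cdot>\<^bsub>C\<^esub> f \<in> homs C X (sh C z W)" using cmp_closed D Wz u by blast
    then have "u \<cdot>\<^bsub>C\<^esub> f = null X (sh C z W)" using assms by (simp add: orthogonal_def)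
    then obtain v where v: "v \<in> homs C Z (sh C z W)" "v \<cdot>\<^bsub>C\<^esub> g = u"
      using factor_through_cone[OF t Wz u] by blast
    then have "v = null Z (sh C z W)" using assms by (simp add: orthogonal_def)
    then show ?thesis using v(2) cmp_null_left[OF D(2,3) Wz D(5)] by simp
  qed
  then show ?thesis using orthogonal_iff assms D by simp
qed

lemma orthogonal_extension_right:
  assumes "has_triangle C X Y Z" "orthogonal C W X" "orthogonal C W Z" "W \<in> Ob C"
  shows "orthogonal C W Y"
proof -
  have "u = null W (sh C z Y)" if u: "u \<in> homs C W (sh C z Y)" for u z
  proof -
    obtain f g h where t: "(sh C z X, sh C z Y, sh C z Z, f, g, h) \<in> dist C"
      using has_triangle_sh[OF assms(1), of z] has_triangle_def by metis
    note D = distD[OF t]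
    have "g \<cdot>\<^bsub>C\<^esub> u \<in> homs C W (sh C z Z)" using cmp_closed D assms u by blast
    then have "g \<cdot>\<^bsub>C\<^esub> u = null W (sh C z Z)" using assms by (simp add: orthogonal_def)
    then obtain v where v: "v \<in> homs C W (sh C z X)" "f \<cdot>\<^bsub>C\<^esub> v = u"
      using lift_through_fibre[OF t assms(4) u] by blast
    then have "v = null W (sh C z X)" using assms by (simp add: orthogonal_def)
    then show ?thesis using v(2) cmp_null_right[OF assms(4) D(1,2,4)] by simp
  qed
  then show ?thesis using orthogonal_iff assms has_triangleD(2)[OF assms(1)] by simp
qed

end

section \<open>Triangulated subcategories\<close>

context triangulated_category
begin

lemma strictly_fullI:
  assumes "S \<subseteq> Ob C" "\<And>Z. zero_object C Z \<Longrightarrow> Z \<in> S" "extension_closed C S"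
  shows "strictly_full C S"
proof -
  have "Y \<in> S" if "X \<in> S" "Y \<in> Ob C" "isomorphic C X Y" for X Y
  proof -
    obtain Z where Z: "zero_object C Z" using zero_object_exists by blast
    have "X \<in> Ob C" using that assms by blast
    then have "has_triangle C X Y Z" using has_triangle_iso that Z by blast
    then show ?thesis
      using assms(2)[OF Z] assms(3) that(1) unfolding extension_closed_def has_triangle_def by blast
  qed
  then show ?thesis using assms(1) unfolding strictly_full_def by blast
qed

text \<open>
  Closure under cones follows from closure under extensions: rotating a triangle makes its third
  term the middle one.
\<close>

lemma triangulated_subcategoryI:
  assumes "S \<subseteq> Ob C" "\<And>Z. zero_object C Z \<Longrightarrow> Z \<in> S" "extension_closed C S"
    and sh: "\<And>X z. X \<in> S \<Longrightarrow> sh C z X \<in> S"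
  shows "triangulated_subcategory C S"
  unfolding triangulated_subcategory_def
proof (intro conjI allI ballI impI)
  show "strictly_full C S" using assms strictly_fullI by blast
  show "S \<noteq> {}" using zero_object_exists assms(2) by blast
  show "sh C z X \<in> S" if "X \<in> S" for X z using sh that by blast
  fix X Y Z f g h
  assume "(X, Y, Z, f, g, h) \<in> dist C" "X \<in> S" "Y \<in> S"
  then show "Z \<in> S" using rotate sh assms(3) unfolding extension_closed_def by blast
qed

lemma triangulated_subcategoryD:
  assumes S: "triangulated_subcategory C S"
  shows triangulated_subset: "S \<subseteq> Ob C"
    and triangulated_zero: "zero_object C Z \<Longrightarrow> Z \<in> S"
    and triangulated_sh: "X \<in> S \<Longrightarrow> sh C z X \<in> S"
    and triangulated_extension: "has_triangle C X Y W \<Longrightarrow> X \<in> S \<Longrightarrow> W \<in> S \<Longrightarrow> Y \<in> S"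
proof -
  show sub: "S \<subseteq> Ob C" and sh: "\<And>X z. X \<in> S \<Longrightarrow> sh C z X \<in> S"
    using S by (auto simp: triangulated_subcategory_def strictly_full_def)
  have cone: "\<And>X Y Z. has_triangle C X Y Z \<Longrightarrow> X \<in> S \<Longrightarrow> Y \<in> S \<Longrightarrow> Z \<in> S"
    using S unfolding triangulated_subcategory_def has_triangle_def by blast
  show "Z \<in> S" if Z: "zero_object C Z"
  proof -
    obtain X where "X \<in> S" using S by (auto simp: triangulated_subcategory_def)
    then show ?thesis using TR1_ident[OF _ Z] cone sub unfolding has_triangle_def by blast
  qed
  show "Y \<in> S" if "has_triangle C X Y W" "X \<in> S" "W \<in> S"
    using has_triangle_rotate_back[OF that(1)] cone sh that by blast
qed

text \<open>
  An object is zero exactly when it is orthogonal to itself, so orthogonality carries the property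
  from the outer terms of a triangle to the middle one.
\<close>

lemma triangulated_zero_objects: "triangulated_subcategory C {Z. zero_object C Z}"
proof (rule triangulated_subcategoryI)
  show "extension_closed C {Z. zero_object C Z}"
    unfolding extension_closed_def
  proof (intro allI impI)
    fix X Y Z f g h
    assume t: "(X, Y, Z, f, g, h) \<in> dist C"
      and "X \<in> {Z. zero_object C Z}" "Z \<in> {Z. zero_object C Z}"
    then have "orthogonal C Y Y"
      using orthogonal_extension_left orthogonal_zero_left distD[OF t]
      unfolding has_triangle_def by blast
    then have "homs C Y Y = {null Y Y}"
      using sh_zero[of Y] distD[OF t] unfolding orthogonal_def by metis
    then show "Y \<in> {Z. zero_object C Z}"
      using zero_object_iff_ident ident_closed distD(2)[OF t] by blast
  qed
qed (auto simp: zero_objectD zero_object_sh)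

lemma
  assumes A: "A \<subseteq> Ob C"
  shows extension_closure_strictly_full: "strictly_full C (extension_closure C A)"
    and extension_closure_extension_closed: "extension_closed C (extension_closure C A)"
    and extension_closure_superset: "A \<subseteq> extension_closure C A"
proof -
  have "strictly_full C (Ob C)" "extension_closed C (Ob C)"
    unfolding strictly_full_def extension_closed_def using distD by blast+
  then have "extension_closure C A \<subseteq> Ob C" unfolding extension_closure_def using A by blast
  then show "strictly_full C (extension_closure C A)"
    unfolding extension_closure_def strictly_full_def by blast
  show "extension_closed C (extension_closure C A)"
    unfolding extension_closure_def extension_closed_def by blast
  show "A \<subseteq> extension_closure C A" unfolding extension_closure_def by blast
qed

lemma extension_closure_subset:
  assumes "A \<subseteq> S" "S \<subseteq> Ob C" "\<And>Z. zero_object C Z \<Longrightarrow> Z \<in> S" "extension_closed C S"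
  shows "extension_closure C A \<subseteq> S"
  using strictly_fullI[OF assms(2-4)] assms(1,4) unfolding extension_closure_def by blast

text \<open>
  The zero objects enter through the triangle \<open>X \<rightarrow> 0 \<rightarrow> X[1]\<close>.
\<close>

lemma extension_closure_triangulated:
  assumes A: "A \<subseteq> Ob C" "A \<noteq> {}" and sh: "\<And>X z. X \<in> A \<Longrightarrow> sh C z X \<in> A"
  shows "triangulated_subcategory C (extension_closure C A)"
proof -
  let ?S = "extension_closure C A"
  note S = extension_closure_strictly_full[OF A(1)] extension_closure_extension_closed[OF A(1)]
    extension_closure_superset[OF A(1)]
  have sub: "?S \<subseteq> Ob C" using S(1) by (simp add: strictly_full_def)
  have zero: "Z \<in> ?S" if Z: "zero_object C Z" for Z
  proof -
    obtain X where X: "X \<in> A" using A by blast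
    then have "X \<in> ?S" "sh C 1 X \<in> ?S" using S(3) sh by auto
    moreover have "X \<in> Ob C" using X A by blast
    ultimately show ?thesis
      using rotate[OF TR1_ident[OF _ Z]] S(2) unfolding extension_closed_def by blast
  qed
  have "?S \<subseteq> {Y \<in> Ob C. sh C z Y \<in> ?S}" for z
  proof (rule extension_closure_subset)
    show "A \<subseteq> {Y \<in> Ob C. sh C z Y \<in> ?S}" using A S(3) sh by blast
    show "Z \<in> {Y \<in> Ob C. sh C z Y \<in> ?S}" if "zero_object C Z" for Z
      using that zero zero_object_sh zero_objectD by blast
    show "extension_closed C {Y \<in> Ob C. sh C z Y \<in> ?S}"
      unfolding extension_closed_def
    proof (intro allI impI)
      fix X Y W f g h
      assume t: "(X, Y, W, f, g, h) \<in> dist C"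
        and XW: "X \<in> {Y \<in> Ob C. sh C z Y \<in> ?S}" "W \<in> {Y \<in> Ob C. sh C z Y \<in> ?S}"
      have "has_triangle C (sh C z X) (sh C z Y) (sh C z W)"
        using has_triangle_sh t unfolding has_triangle_def by blast
      then have "sh C z Y \<in> ?S"
        using XW S(2) unfolding has_triangle_def extension_closed_def by blast
      then show "Y \<in> {Y \<in> Ob C. sh C z Y \<in> ?S}" using distD(2)[OF t] by blast
    qed
  qed auto
  then show ?thesis using triangulated_subcategoryI[OF sub zero S(2)] by blast
qed

text \<open>
  Orthogonality spreads from the generators in one variable at a time: first the left argument runs
  through the closure of \<open>A\<close> with the right one in \<open>B\<close>, then the right argument.
\<close>

lemma extension_closure_orthogonal:
  assumes "A \<subseteq> Ob C" "B \<subseteq> Ob C" and AB: "\<And>X Y. X \<in> A \<Longrightarrow> Y \<in> B \<Longrightarrow> orthogonal C X Y"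
    and X: "X \<in> extension_closure C A" and Y: "Y \<in> extension_closure C B"
  shows "orthogonal C X Y"
proof -
  have "extension_closure C A \<subseteq> {X \<in> Ob C. orthogonal C X Y}" if "Y \<in> B" for Y
  proof (rule extension_closure_subset)
    show "extension_closed C {X \<in> Ob C. orthogonal C X Y}"
      unfolding extension_closed_def
      using orthogonal_extension_left that assms(2) distD(2) unfolding has_triangle_def by blast
  qed (use assms(1,2) AB that orthogonal_zero_left zero_objectD in auto)
  then have XB: "orthogonal C X Y" if "Y \<in> B" for Y using that X by blast
  have XO: "X \<in> Ob C"
    using X extension_closure_strictly_full[OF assms(1)] by (auto simp: strictly_full_def)
  have "extension_closure C B \<subseteq> {Y \<in> Ob C. orthogonal C X Y}"
  proof (rule extension_closure_subset)
    show "extension_closed C {Y \<in> Ob C. orthogonal C X Y}"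
      unfolding extension_closed_def
      using orthogonal_extension_right XO distD(2) unfolding has_triangle_def by blast
  qed (use assms(2) XB XO orthogonal_zero_right zero_objectD in auto)
  then show ?thesis using Y by blast
qed

section \<open>Extensions of one subcategory by another\<close>

text \<open>
  The inclusion \<open>(A * B) * D \<subseteq> A * (B * D)\<close>; the next lemma is the reverse inclusion, obtained
  from it by rotation.
\<close>

lemma octahedral_cone:
  assumes "has_triangle C X Y A" "has_triangle C Y Z B"
  obtains D where "has_triangle C X Z D" "has_triangle C A D B"
proof -
  obtain f p d g q e where t: "(X, Y, A, f, p, d) \<in> dist C" "(Y, Z, B, g, q, e) \<in> dist C"
    using assms unfolding has_triangle_def by blast
  note D = distD[OF t(1)] distD[OF t(2)]
  have "g \<cdot>\<^bsub>C\<^esub> f \<in> homs C X Z" using cmp_closed[OF D(1,2,8,4,10)] .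
  then obtain D r s where "(X, Z, D, g \<cdot>\<^bsub>C\<^esub> f, r, s) \<in> dist C"
    using TR1_cone[OF D(1,8)] by blast
  with TR4[OF t this] show ?thesis using that unfolding has_triangle_def by blast
qed

lemma octahedral_fibre:
  assumes "has_triangle C X Y N" "has_triangle C Z N W"
  obtains D where "has_triangle C D Y W" "has_triangle C X D Z"
proof -
  note ob = has_triangleD[OF assms(1)] has_triangleD[OF assms(2)]
  obtain D where D: "has_triangle C Y W D" "has_triangle C (sh C 1 X) D (sh C 1 Z)"
    using octahedral_cone[OF has_triangle_rotate[OF assms(1)] has_triangle_rotate[OF assms(2)]]
    by blast
  have "has_triangle C X (sh C (- 1) D) Z"
    using has_triangle_sh[OF D(2), of "- 1"] sh_uminus(2)[of _ 1] ob by simp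
  then show ?thesis using that has_triangle_rotate_back[OF D(1)] by blast
qed

text \<open>
  Since \<open>h = 0\<close>, the morphism \<open>g\<close> has a section \<open>s\<close>, and \<open>X'\<close> is its cone.  In fact
  \<open>X'\<close> is isomorphic to \<open>X\<close>, but the triangle \<open>X \<rightarrow> X' \<rightarrow> 0\<close>, which the octahedral axiom for
  \<open>g s = id\<close> provides up to rotation, already places \<open>X'\<close> in every extension-closed class that contains
  \<open>X\<close> and the zero objects.
\<close>

lemma split_triangle_swap:
  assumes "has_triangle C X Y Z" "orthogonal C Z X" "zero_object C U"
  obtains X' where "has_triangle C Z Y X'" "has_triangle C X X' U"
proof -
  obtain f g h where t: "(X, Y, Z, f, g, h) \<in> dist C" using assms has_triangle_def by metis
  note D = distD[OF t]
  have X1: "sh C 1 X \<in> Ob C" using D sh_closed by blast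
  have "h = null Z (sh C 1 X)" using assms(2) D by (simp add: orthogonal_def)
  then have "h \<cdot>\<^bsub>C\<^esub> ident C Z = null Z (sh C 1 X)" using cmp_ident_right[OF D(3) X1 D(6)] by simp
  then obtain s where s: "s \<in> homs C Z Y" "g \<cdot>\<^bsub>C\<^esub> s = ident C Z"
    using lift_through_fibre[OF rotate[OF t] D(3) ident_closed[OF D(3)]] by blast
  obtain X' p q where X': "(Z, Y, X', s, p, q) \<in> dist C"
    using TR1_cone[OF D(3,2) s(1)] by blast
  have "(Z, Z, U, g \<cdot>\<^bsub>C\<^esub> s, null Z U, null U (sh C 1 Z)) \<in> dist C"
    using TR1_ident[OF D(3) assms(3)] s by simp
  from TR4[OF X' rotate[OF t] this] have "has_triangle C X' U (sh C 1 X)"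
    unfolding has_triangle_def by blast
  from has_triangle_rotate_back[OF this] have "has_triangle C X X' U"
    using sh_uminus(2)[OF D(1), of 1] by simp
  then show ?thesis using that X' unfolding has_triangle_def by blast
qed

end

definition extensions :: "('o, 'm, 'k) tri_cat \<Rightarrow> 'o set \<Rightarrow> 'o set \<Rightarrow> 'o set" where
  "extensions C A B = {Y. \<exists>X\<in>A. \<exists>Z\<in>B. has_triangle C X Y Z}"

context triangulated_category
begin

lemma extensionsI: "X \<in> A \<Longrightarrow> Z \<in> B \<Longrightarrow> has_triangle C X Y Z \<Longrightarrow> Y \<in> extensions C A B"
  unfolding extensions_def by blast

lemma extensionsE:
  assumes "Y \<in> extensions C A B"
  obtains X Z where "X \<in> A" "Z \<in> B" "has_triangle C X Y Z"
  using assms unfolding extensions_def by blast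

text \<open>
  An extension of \<open>N \<in> A * B\<close> by \<open>M \<in> A * B\<close> is first rebracketed as \<open>A * ((B * A) * B)\<close>.
  The inner factor \<open>B * A\<close> is turned into \<open>A * B\<close> by splitting, and rebracketing again collects
  the two factors \<open>A\<close> and the two factors \<open>B\<close>.
\<close>

lemma extensions_triangulated:
  assumes A: "triangulated_subcategory C A" and B: "triangulated_subcategory C B"
    and AB: "\<And>X Y. X \<in> A \<Longrightarrow> Y \<in> B \<Longrightarrow> orthogonal C X Y"
  shows "triangulated_subcategory C (extensions C A B)"
    and "A \<subseteq> extensions C A B" and "B \<subseteq> extensions C A B"
proof -
  note A' = triangulated_subcategoryD[OF A] and B' = triangulated_subcategoryD[OF B]
  obtain U where U: "zero_object C U" using zero_object_exists by blast
  show AX: "A \<subseteq> extensions C A B"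
  proof
    fix X assume X: "X \<in> A"
    then have "X \<in> Ob C" using A' by blast
    then have "has_triangle C X X U"
      using TR1_ident[OF _ U] unfolding has_triangle_def by blast
    then show "X \<in> extensions C A B" using X B'(2)[OF U] extensionsI by blast
  qed
  show "B \<subseteq> extensions C A B"
  proof
    fix X assume X: "X \<in> B"
    then have "X \<in> Ob C" using B' by blast
    from has_triangle_zero_left[OF U this] show "X \<in> extensions C A B"
      using X A'(2)[OF U] extensionsI by blast
  qed
  have swap: "Y \<in> extensions C A B" if t: "has_triangle C X Y Z" and XZ: "X \<in> B" "Z \<in> A"
    for X Y Z
  proof -
    obtain X' where "has_triangle C Z Y X'" "has_triangle C X X' U"
      using split_triangle_swap[OF t AB[OF XZ(2,1)] U] by blast
    then show ?thesis using XZ B'(2)[OF U] B'(4)[of X X' U] extensionsI by blast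
  qed
  show "triangulated_subcategory C (extensions C A B)"
  proof (rule triangulated_subcategoryI)
    show "extensions C A B \<subseteq> Ob C"
      using has_triangleD by (auto elim: extensionsE)
    show "Z \<in> extensions C A B" if "zero_object C Z" for Z
      using A'(2)[OF that] AX by blast
    show "sh C z X \<in> extensions C A B" if "X \<in> extensions C A B" for X z
      using that by (rule extensionsE) (use A'(3) B'(3) has_triangle_sh extensionsI in blast)
    show "extension_closed C (extensions C A B)"
      unfolding extension_closed_def
    proof (intro allI impI)
      fix M Y N f g h
      assume t: "(M, Y, N, f, g, h) \<in> dist C"
        and M: "M \<in> extensions C A B" and N: "N \<in> extensions C A B"
      then have Y: "has_triangle C M Y N" unfolding has_triangle_def by blast
      obtain a b where M: "a \<in> A" "b \<in> B" "has_triangle C a M b" using M by (rule extensionsE)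
      obtain a' b' where N: "a' \<in> A" "b' \<in> B" "has_triangle C a' N b'" using N by (rule extensionsE)
      obtain R where R: "has_triangle C a Y R" "has_triangle C b R N"
        using octahedral_cone[OF M(3) Y] by blast
      obtain P where P: "has_triangle C P R b'" "has_triangle C b P a'"
        using octahedral_fibre[OF R(2) N(3)] by blast
      obtain a'' b'' where S: "a'' \<in> A" "b'' \<in> B" "has_triangle C a'' P b''"
        using swap[OF P(2) M(2) N(1)] by (rule extensionsE)
      obtain c where c: "has_triangle C a'' R c" "has_triangle C b'' c b'"
        using octahedral_cone[OF S(3) P(1)] by blast
      obtain d where d: "has_triangle C d Y c" "has_triangle C a d a''"
        using octahedral_fibre[OF R(1) c(1)] by blast
      have "d \<in> A" "c \<in> B" using A'(4)[OF d(2) M(1) S(1)] B'(4)[OF c(2) S(2) N(2)] .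
      then show "Y \<in> extensions C A B" using d(1) by (rule extensionsI)
    qed
  qed
qed

section \<open>Finite direct sums\<close>

text \<open>
  The next morphism \<open>q : A \<rightarrow> X[1]\<close> is zero, since \<open>i[1] q = 0\<close> and \<open>i[1]\<close> is again a split
  monomorphism; every morphism that kills \<open>p\<close> factors through \<open>q\<close>.
\<close>

lemma split_mono_cone_epi:
  assumes t: "(X, S, A, i, p, q) \<in> dist C"
    and r: "r \<in> homs C S X" "r \<cdot>\<^bsub>C\<^esub> i = ident C X"
    and W: "W \<in> Ob C" and u: "u \<in> homs C A W" "u \<cdot>\<^bsub>C\<^esub> p = null S W"
  shows "u = null A W"
proof -
  note D = distD[OF t]
  let ?X = "sh C 1 X" and ?S = "sh C 1 S"
  have ob: "?X \<in> Ob C" "?S \<in> Ob C" using D sh_closed by auto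
  have i1: "shm C 1 i \<in> homs C ?X ?S" and r1: "shm C 1 r \<in> homs C ?S ?X"
    using D r shm_closed by auto
  have "(\<ominus>\<^bsub>Hm C ?X ?S\<^esub> (shm C 1 i)) \<cdot>\<^bsub>C\<^esub> q = null A ?S"
    using dist_cmp_null[OF rotate[OF rotate[OF t]]] .
  then have "\<ominus>\<^bsub>Hm C A ?S\<^esub> (shm C 1 i \<cdot>\<^bsub>C\<^esub> q) = null A ?S"
    using cmp_minus_left[OF D(3) ob D(6) i1] by simp
  then have iq: "shm C 1 i \<cdot>\<^bsub>C\<^esub> q = null A ?S"
    using minus_eq_nullD[OF D(3) ob(2) cmp_closed[OF D(3) ob D(6) i1]] by simp
  have "q = ident C ?X \<cdot>\<^bsub>C\<^esub> q" using cmp_ident_left[OF D(3) ob(1) D(6)] by simp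
  also have "\<dots> = (shm C 1 r \<cdot>\<^bsub>C\<^esub> shm C 1 i) \<cdot>\<^bsub>C\<^esub> q"
    using shm_cmp[OF D(1,2,1,4) r(1), of 1] r(2) shm_ident[OF D(1), of 1] by simp
  also have "\<dots> = shm C 1 r \<cdot>\<^bsub>C\<^esub> (shm C 1 i \<cdot>\<^bsub>C\<^esub> q)"
    using cmp_assoc[OF D(3) ob(1,2,1) D(6) i1 r1] .
  also have "\<dots> = null A ?X" using iq cmp_null_right[OF D(3) ob(2,1) r1] by simp
  finally have q: "q = null A ?X" .
  obtain v where "v \<in> homs C ?X W" "v \<cdot>\<^bsub>C\<^esub> q = u"
    using factor_through_cone[OF rotate[OF t] W u] by blast
  then show ?thesis using q cmp_null_right[OF D(3) ob(1) W] by simp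
qed

text \<open>
  By induction on the number of summands: the cone \<open>A\<close> of \<open>\<iota>\<^sub>i\<close> is a direct sum of the remaining
  ones, so \<open>S\<close> is an extension of \<open>A\<close> by \<open>X\<^sub>i\<close>.  The last hypothesis, that the inclusions are
  jointly epimorphic, replaces the equation \<open>\<Sum> \<iota>\<^sub>i \<pi>\<^sub>i = id\<close> because it passes to the cone without
  any computation with sums.
\<close>

lemma triangulated_split_summands:
  assumes V: "triangulated_subcategory C V" and "finite I" "S \<in> Ob C"
    and "\<And>i. i \<in> I \<Longrightarrow> X i \<in> V"
    and "\<And>i. i \<in> I \<Longrightarrow> \<iota> i \<in> homs C (X i) S" "\<And>i. i \<in> I \<Longrightarrow> \<pi> i \<in> homs C S (X i)"
    and "\<And>i j. i \<in> I \<Longrightarrow> j \<in> I \<Longrightarrow>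
      \<pi> i \<cdot>\<^bsub>C\<^esub> \<iota> j = (if i = j then ident C (X i) else null (X j) (X i))"
    and "\<And>W u. W \<in> Ob C \<Longrightarrow> u \<in> homs C S W \<Longrightarrow>
      (\<And>i. i \<in> I \<Longrightarrow> u \<cdot>\<^bsub>C\<^esub> \<iota> i = null (X i) W) \<Longrightarrow> u = null S W"
  shows "S \<in> V"
  using assms(2-)
proof (induction I arbitrary: S \<iota> \<pi>)
  case empty
  then have "zero_object C S" using zero_object_iff_ident ident_closed by blast
  then show ?case using triangulated_zero[OF V] by blast
next
  case (insert i I)
  note S = insert.prems(1) and X = insert.prems(2) and \<iota> = insert.prems(3)
    and \<pi> = insert.prems(4) and \<delta> = insert.prems(5) and epi = insert.prems(6)
  have XO: "X j \<in> Ob C" if "j \<in> insert i I" for j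
    using X[OF that] triangulated_subset[OF V] by blast
  obtain A p q where t: "(X i, S, A, \<iota> i, p, q) \<in> dist C"
    using TR1_cone[OF XO[of i] S \<iota>[of i]] by blast
  note D = distD[OF t]
  have "\<exists>\<rho>. \<rho> \<in> homs C A (X j) \<and> \<rho> \<cdot>\<^bsub>C\<^esub> p = \<pi> j" if "j \<in> I" for j
  proof -
    have "\<pi> j \<cdot>\<^bsub>C\<^esub> \<iota> i = null (X i) (X j)" using \<delta>[of j i] that insert.hyps by auto
    then show ?thesis using factor_through_cone[OF t XO[of j] \<pi>[of j]] that by blast
  qed
  then obtain \<rho> where \<rho>: "\<And>j. j \<in> I \<Longrightarrow> \<rho> j \<in> homs C A (X j)"
    "\<And>j. j \<in> I \<Longrightarrow> \<rho> j \<cdot>\<^bsub>C\<^esub> p = \<pi> j" by metis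
  have "A \<in> V"
  proof (rule insert.IH[where \<iota> = "\<lambda>j. p \<cdot>\<^bsub>C\<^esub> \<iota> j" and \<pi> = \<rho>])
    show "A \<in> Ob C" using D by blast
    show "X j \<in> V" if "j \<in> I" for j using X that by blast
    show "p \<cdot>\<^bsub>C\<^esub> \<iota> j \<in> homs C (X j) A" if "j \<in> I" for j
      using cmp_closed[OF XO S D(3) \<iota> D(5)] that by simp
    show "\<rho> j \<in> homs C A (X j)" if "j \<in> I" for j using \<rho> that by blast
    show "\<rho> j \<cdot>\<^bsub>C\<^esub> (p \<cdot>\<^bsub>C\<^esub> \<iota> l) = (if j = l then ident C (X j) else null (X l) (X j))"
      if "j \<in> I" "l \<in> I" for j l
    proof -
      have "\<rho> j \<cdot>\<^bsub>C\<^esub> (p \<cdot>\<^bsub>C\<^esub> \<iota> l) = (\<rho> j \<cdot>\<^bsub>C\<^esub> p) \<cdot>\<^bsub>C\<^esub> \<iota> l"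
        using cmp_assoc[OF XO S D(3) XO \<iota> D(5) \<rho>(1)] that by simp
      then show ?thesis using \<rho>(2) \<delta>[of j l] that by simp
    qed
    show "u = null A W" if W: "W \<in> Ob C" and u: "u \<in> homs C A W"
      and uj: "\<And>j. j \<in> I \<Longrightarrow> u \<cdot>\<^bsub>C\<^esub> (p \<cdot>\<^bsub>C\<^esub> \<iota> j) = null (X j) W" for W u
    proof -
      have up: "u \<cdot>\<^bsub>C\<^esub> p \<in> homs C S W" using cmp_closed[OF D(2,3) W D(5) u] .
      have "(u \<cdot>\<^bsub>C\<^esub> p) \<cdot>\<^bsub>C\<^esub> \<iota> j = null (X j) W" if j: "j \<in> insert i I" for j
      proof -
        have "(u \<cdot>\<^bsub>C\<^esub> p) \<cdot>\<^bsub>C\<^esub> \<iota> j = u \<cdot>\<^bsub>C\<^esub> (p \<cdot>\<^bsub>C\<^esub> \<iota> j)"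
          using cmp_assoc[OF XO[OF j] S D(3) W \<iota>[OF j] D(5) u] .
        then show ?thesis
          using uj j dist_cmp_null[OF t] cmp_null_right[OF D(1,3) W u] by auto
      qed
      then have "u \<cdot>\<^bsub>C\<^esub> p = null S W" using epi[OF W up] by blast
      then show ?thesis
        using split_mono_cone_epi[OF t \<pi> _ W u] \<delta>[of i i] by simp
    qed
  qed
  moreover have "has_triangle C (X i) S A" using t unfolding has_triangle_def by blast
  ultimately show ?case using triangulated_extension[OF V] X by blast
qed

lemma triangulated_direct_sum:
  assumes V: "triangulated_subcategory C V" and S: "is_direct_sum C I X S"
    and X: "\<And>i. i \<in> I \<Longrightarrow> X i \<in> V"
  shows "S \<in> V"
proof -
  obtain \<iota> \<pi> where "direct_sum C I X S \<iota> \<pi>" using S unfolding is_direct_sum_def by blast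
  then have D: "finite I" "S \<in> Ob C" "\<And>i. i \<in> I \<Longrightarrow> X i \<in> Ob C"
    "\<And>i. i \<in> I \<Longrightarrow> \<iota> i \<in> homs C (X i) S" "\<And>i. i \<in> I \<Longrightarrow> \<pi> i \<in> homs C S (X i)"
    "\<And>i j. i \<in> I \<Longrightarrow> j \<in> I \<Longrightarrow>
      \<pi> i \<cdot>\<^bsub>C\<^esub> \<iota> j = (if i = j then ident C (X i) else null (X j) (X i))"
    "finsum (Hm C S S) (\<lambda>i. \<iota> i \<cdot>\<^bsub>C\<^esub> \<pi> i) I = ident C S"
    unfolding direct_sum_def by simp_all
  show ?thesis
  proof (rule triangulated_split_summands[OF V D(1,2) X D(4,5,6)])
    fix W u
    assume W: "W \<in> Ob C" and u: "u \<in> homs C S W"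
      and ui: "\<And>i. i \<in> I \<Longrightarrow> u \<cdot>\<^bsub>C\<^esub> \<iota> i = null (X i) W"
    have "u \<cdot>\<^bsub>C\<^esub> (\<iota> i \<cdot>\<^bsub>C\<^esub> \<pi> i) = null S W" if i: "i \<in> I" for i
      using cmp_assoc[OF D(2) D(3)[OF i] D(2) W D(5)[OF i] D(4)[OF i] u] ui[OF i]
        cmp_null_left[OF D(2) D(3)[OF i] W D(5)[OF i]] by simp
    then have "u \<cdot>\<^bsub>C\<^esub> ident C S = null S W"
      unfolding D(7)[symmetric]
      using cmp_closed[OF D(2) D(3) D(2) D(5) D(4)] by (intro cmp_finsum_null D(1,2) W u) auto
    then show "u = null S W" using cmp_ident_right[OF D(2) W u] by simp
  qed
qed

end

section \<open>Iterated extensions and filtrations\<close>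

definition semiorthogonal_family ::
  "('o, 'm, 'k) tri_cat \<Rightarrow> 'p::linorder set \<Rightarrow> ('p \<Rightarrow> 'o set) \<Rightarrow> bool" where
  "semiorthogonal_family C \<Phi> P \<longleftrightarrow>
     (\<forall>p\<in>\<Phi>. triangulated_subcategory C (P p)) \<and>
     (\<forall>p\<in>\<Phi>. \<forall>q\<in>\<Phi>. p < q \<longrightarrow> (\<forall>X\<in>P q. \<forall>Y\<in>P p. orthogonal C X Y))"

lemma semiorthogonal_family_mono:
  "semiorthogonal_family C \<Psi> P \<Longrightarrow> \<Phi> \<subseteq> \<Psi> \<Longrightarrow> semiorthogonal_family C \<Phi> P"
  unfolding semiorthogonal_family_def by blast

primrec layers :: "('o, 'm, 'k) tri_cat \<Rightarrow> ('p \<Rightarrow> 'o set) \<Rightarrow> 'p list \<Rightarrow> 'o set" where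
  "layers C P [] = {Z. zero_object C Z}"
| "layers C P (p # ps) = extensions C (layers C P ps) (P p)"

context triangulated_category
begin

text \<open>
  Applied with \<open>W \<in> P p\<close> for an index \<open>p\<close> below all of \<open>ps\<close>, this provides the orthogonality
  under which one more layer may be added.
\<close>

lemma layers_orthogonal:
  assumes "W \<in> Ob C" "\<And>p X. p \<in> set ps \<Longrightarrow> X \<in> P p \<Longrightarrow> orthogonal C X W" "X \<in> layers C P ps"
  shows "orthogonal C X W"
  using assms(2,3)
proof (induction ps arbitrary: X)
  case Nil
  then show ?case using orthogonal_zero_left assms(1) by simp
next
  case (Cons p ps)
  then obtain M Q where "M \<in> layers C P ps" "Q \<in> P p" "has_triangle C M X Q"
    by (auto elim: extensionsE)
  then show ?case using Cons orthogonal_extension_left[OF _ _ _ assms(1)] by (metis list.set_intros)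
qed

lemma layers_triangulated:
  assumes "sorted_wrt (<) ps" "semiorthogonal_family C (set ps) P"
  shows "triangulated_subcategory C (layers C P ps)" (is ?tri)
    and "p \<in> set ps \<Longrightarrow> P p \<subseteq> layers C P ps"
proof -
  have "?tri \<and> (\<forall>p\<in>set ps. P p \<subseteq> layers C P ps)"
    using assms
  proof (induction ps)
    case Nil
    then show ?case using triangulated_zero_objects by simp
  next
    case (Cons p ps)
    have "semiorthogonal_family C (set ps) P"
      using semiorthogonal_family_mono[OF Cons.prems(2)] by auto
    then have IH: "triangulated_subcategory C (layers C P ps)" "\<forall>p\<in>set ps. P p \<subseteq> layers C P ps"
      using Cons.IH Cons.prems(1) by auto
    have Pp: "triangulated_subcategory C (P p)"
      using Cons.prems(2) by (simp add: semiorthogonal_family_def)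
    have orth: "orthogonal C X Y" if X: "X \<in> layers C P ps" and Y: "Y \<in> P p" for X Y
    proof (rule layers_orthogonal[OF _ _ X])
      show "Y \<in> Ob C" using triangulated_subset[OF Pp] Y by blast
      show "orthogonal C X Y" if "q \<in> set ps" "X \<in> P q" for q X
        using Cons.prems that Y by (simp add: semiorthogonal_family_def)
    qed
    show ?case using extensions_triangulated[OF IH(1) Pp orth] IH(2) by fastforce
  qed
  then show ?tri "p \<in> set ps \<Longrightarrow> P p \<subseteq> layers C P ps" by blast+
qed

lemma filtration_mono:
  "filtration C \<Phi> P X m F Q \<phi> \<Longrightarrow> \<Phi> \<subseteq> \<Psi> \<Longrightarrow> filtration C \<Psi> P X m F Q \<phi>"
  unfolding filtration_def by blast

lemma filtration_single:
  assumes "has_triangle C M X R" "zero_object C M" "p \<in> \<Phi>" "R \<in> P p" "\<not> zero_object C R"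
  shows "filtration C \<Phi> P X 0 (case_nat X (\<lambda>_. M)) (\<lambda>_. R) (\<lambda>_. p)"
  using assms unfolding filtration_def has_triangle_def by simp

lemma filtration_Cons:
  assumes "has_triangle C M X R" "p \<in> \<Phi>" "R \<in> P p" "\<not> zero_object C R"
    and fil: "filtration C \<Psi> P M m F Q \<phi>" and "\<Psi> \<subseteq> \<Phi>" "\<And>q. q \<in> \<Psi> \<Longrightarrow> p < q"
  shows "filtration C \<Phi> P X (Suc m) (case_nat X F) (case_nat R Q) (case_nat p \<phi>)"
  unfolding filtration_def
proof (intro conjI allI impI)
  show "case_nat X F 0 = X" by simp
  show "zero_object C (case_nat X F (Suc (Suc m)))" using fil by (simp add: filtration_def)
  fix i
  show "\<exists>f g h. (case_nat X F (Suc i), case_nat X F i, case_nat R Q i, f, g, h) \<in> dist C"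
    "case_nat p \<phi> i \<in> \<Phi>" "case_nat R Q i \<in> P (case_nat p \<phi> i)"
    "\<not> zero_object C (case_nat R Q i)" if "i \<le> Suc m"
    using that assms by (auto simp: filtration_def has_triangle_def split: nat.split)
  show "case_nat p \<phi> i < case_nat p \<phi> (Suc i)" if "i < Suc m"
    using that assms by (auto simp: filtration_def split: nat.split)
qed

lemma layers_filtration:
  assumes "sorted_wrt (<) ps" "semiorthogonal_family C (set ps) P"
    and "X \<in> layers C P ps" "\<not> zero_object C X"
  shows "\<exists>m F Q \<phi>. filtration C (set ps) P X m F Q \<phi>"
  using assms
proof (induction ps arbitrary: X)
  case Nil
  then show ?case by simp
next
  case (Cons p ps)
  have ps: "sorted_wrt (<) ps" "semiorthogonal_family C (set ps) P"
    using Cons.prems(1) semiorthogonal_family_mono[OF Cons.prems(2)] by auto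
  note IH = Cons.IH[OF ps] and V = layers_triangulated(1)[OF ps]
  obtain M R where M: "M \<in> layers C P ps" "R \<in> P p" "has_triangle C M X R"
    using Cons.prems(3) by (auto elim: extensionsE)
  (* A zero quotient must not appear in a filtration, and the zero object has no filtration. *)
  consider "zero_object C R" | "\<not> zero_object C R" "zero_object C M"
    | "\<not> zero_object C R" "\<not> zero_object C M" by blast
  then show ?case
  proof cases
    case 1
    then have "X \<in> layers C P ps"
      using triangulated_extension[OF V M(3,1)] triangulated_zero[OF V] by blast
    then obtain m F Q \<phi> where "filtration C (set ps) P X m F Q \<phi>"
      using IH Cons.prems(4) by blast
    from filtration_mono[OF this set_subset_Cons] show ?thesis by blast
  next
    case 2
    have "filtration C (set (p # ps)) P X 0 (case_nat X (\<lambda>_. M)) (\<lambda>_. R) (\<lambda>_. p)"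
      by (intro filtration_single[OF M(3)]) (use 2 M(2) in auto)
    then show ?thesis by blast
  next
    case 3
    then obtain m F Q \<phi> where "filtration C (set ps) P M m F Q \<phi>" using IH M by blast
    then have "filtration C (set (p # ps)) P X (Suc m) (case_nat X F) (case_nat R Q) (case_nat p \<phi>)"
      using Cons.prems(1) M(2) 3 by (intro filtration_Cons[OF M(3)]) auto
    then show ?thesis by blast
  qed
qed

section \<open>Semiorthogonal families as t-stabilities\<close>

text \<open>
  As every \<open>P i\<close> is stable under shifts, the automorphism of the index set is the identity.  The
  hypothesis on generation is applied to the iterated product of all the \<open>P i\<close>.
\<close>

lemma t_stability_of_semiorthogonal:
  fixes n :: nat
  assumes P: "semiorthogonal_family C {0..n} P"
    and gen: "\<And>V. triangulated_subcategory C V \<Longrightarrow> (\<And>i. i \<le> n \<Longrightarrow> P i \<subseteq> V) \<Longrightarrow> Ob C \<subseteq> V"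
  shows "t_stability C {0..n} P"
  unfolding t_stability_def
proof (intro conjI ballI impI allI exI[of _ id])
  fix i assume i: "i \<in> {0..n}"
  then have Pi: "triangulated_subcategory C (P i)"
    using P by (simp add: semiorthogonal_family_def)
  show "P i \<noteq> {}" "strictly_full C (P i)" using Pi by (auto simp: triangulated_subcategory_def)
  show "extension_closed C (P i)"
    using triangulated_extension[OF Pi] unfolding extension_closed_def has_triangle_def by blast
  show "Z \<in> P i" if "zero_object C Z" for Z using triangulated_zero[OF Pi that] .
  show "sh C 1 ` P i = P (id i)"
  proof
    show "sh C 1 ` P i \<subseteq> P (id i)" using triangulated_sh[OF Pi] by auto
    show "P (id i) \<subseteq> sh C 1 ` P i"
    proof
      fix X assume X: "X \<in> P (id i)"
      then have "X = sh C 1 (sh C (- 1) X)"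
        using triangulated_subset[OF Pi] sh_uminus(1)[of X 1] by auto
      then show "X \<in> sh C 1 ` P i" using triangulated_sh[OF Pi, of X "- 1"] X by auto
    qed
  qed
  show "i \<le> id i" by simp
  show "hom_nonpos_zero C (P j) (P i)" if "j \<in> {0..n}" "i < j" for j
    using P i that unfolding semiorthogonal_family_def hom_nonpos_zero_def orthogonal_def by blast
next
  show "bij_betw id {0..n} {0..n}" "strict_mono_on {0..n} (id :: nat \<Rightarrow> nat)"
    by (auto simp: strict_mono_on_def)
next
  fix X assume X: "X \<in> Ob C" "\<not> zero_object C X"
  let ?ps = "[0..<Suc n]"
  have set: "set ?ps = {0..n}" by auto
  have ps: "sorted_wrt (<) ?ps" "semiorthogonal_family C (set ?ps) P"
    unfolding set using P by (simp_all del: upt_Suc)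
  have "Ob C \<subseteq> layers C P ?ps"
    using layers_triangulated[OF ps] unfolding set by (intro gen) auto
  then have "X \<in> layers C P ?ps" using X by blast
  from layers_filtration[OF ps this X(2)]
  show "\<exists>m F Q \<phi>. filtration C {0..n} P X m F Q \<phi>" unfolding set .
qed

text \<open>
  A single morphism of degree \<open>z\<close>, extended by zero, is an element of the graded space of
  morphisms, which vanishes by assumption.
\<close>

lemma exceptional_collection_orthogonal:
  assumes E: "exceptional_collection K C n E" and ij: "i < j" "j \<le> n"
  shows "orthogonal C (E j) (E i)"
proof -
  have ob: "E i \<in> Ob C" "E j \<in> Ob C"
    using E ij by (auto simp: exceptional_collection_def exceptional_def)
  have zero: "f = (\<lambda>z. null (E j) (sh C z (E i)))" if "f \<in> carrier (graded_hom C (E j) (E i))" for f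
  proof -
    have "carrier (graded_hom C (E j) (E i)) = {\<zero>\<^bsub>graded_hom C (E j) (E i)\<^esub>}"
      using E ij unfolding exceptional_collection_def by blast
    then show ?thesis using that by (auto simp: graded_hom_def)
  qed
  have "u = null (E j) (sh C z (E i))" if u: "u \<in> homs C (E j) (sh C z (E i))" for u z
  proof -
    let ?f = "\<lambda>y. if y = z then u else null (E j) (sh C y (E i))"
    have "{y. ?f y \<noteq> null (E j) (sh C y (E i))} \<subseteq> {z}" by auto
    then have "finite {y. ?f y \<noteq> null (E j) (sh C y (E i))}" by (rule finite_subset) simp
    then have "?f \<in> carrier (graded_hom C (E j) (E i))"
      using u ob null_closed sh_closed by (simp add: graded_hom_def)
    from fun_cong[OF zero[OF this], of z] show ?thesis by simp
  qed
  then show ?thesis using orthogonal_iff ob by simp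
qed

lemma graded_sums_subset:
  assumes V: "triangulated_subcategory C V" and E: "\<And>i. i \<le> n \<Longrightarrow> E i \<in> V"
  shows "graded_sums C n E \<subseteq> V"
proof
  fix S assume "S \<in> graded_sums C n E"
  then obtain d W where W: "\<And>i. i \<le> n \<Longrightarrow> graded_tensor C (d i) (E i) (W i)"
    and S: "is_direct_sum C {..n} W S"
    unfolding graded_sums_def by blast
  have "W i \<in> V" if "i \<le> n" for i
    by (rule triangulated_direct_sum[OF V W[OF that, unfolded graded_tensor_def]])
      (use E[OF that] triangulated_sh[OF V] in auto)
  then show "S \<in> V" using triangulated_direct_sum[OF V S] by simp
qed

end

theorem proposition3p7:
  fixes K :: "('k, 'a) ring_scheme"
    and C :: "('o, 'm, 'k) tri_cat"
    and n :: nat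
    and E :: "nat \<Rightarrow> 'o"
  assumes "linear_triangulated_category K C"
    and "exceptional_collection K C n E"
    and "generated_by C n E"
  shows "t_stability C {0..n} (\<lambda>i. extension_closure C {sh C z (E i) | z. True})"
proof -
  interpret linear_triangulated_category K C by fact
  let ?A = "\<lambda>i. {sh C z (E i) | z. True}"
  have E: "E i \<in> Ob C" if "i \<le> n" for i
    using assms(2) that by (simp add: exceptional_collection_def exceptional_def)
  have A: "?A i \<subseteq> Ob C" if "i \<le> n" for i using E[OF that] sh_closed by blast
  have tri: "triangulated_subcategory C (extension_closure C (?A i))" if i: "i \<le> n" for i
  proof (rule extension_closure_triangulated[OF A[OF i]])
    show "sh C z X \<in> ?A i" if "X \<in> ?A i" for X z
      using that sh_add[OF E[OF i], symmetric] by auto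
  qed auto
  have orth: "orthogonal C X Y" if ij: "i < j" "j \<le> n"
    and X: "X \<in> extension_closure C (?A j)" and Y: "Y \<in> extension_closure C (?A i)" for i j X Y
  proof -
    have i: "i \<le> n" using ij by simp
    have "orthogonal C X' Y'" if "X' \<in> ?A j" "Y' \<in> ?A i" for X' Y'
      using that exceptional_collection_orthogonal[OF assms(2) ij] E[OF i] E[OF ij(2)]
        orthogonal_sh_left orthogonal_sh_right sh_closed by blast
    then show ?thesis
      using extension_closure_orthogonal[OF A[OF ij(2)] A[OF i] _ X Y] by blast
  qed
  show ?thesis
  proof (rule t_stability_of_semiorthogonal)
    show "semiorthogonal_family C {0..n} (\<lambda>i. extension_closure C (?A i))"
      unfolding semiorthogonal_family_def using tri orth by simp
  next
    fix V
    assume V: "triangulated_subcategory C V"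
      and sub: "\<And>i. i \<le> n \<Longrightarrow> extension_closure C (?A i) \<subseteq> V"
    have "E i \<in> V" if "i \<le> n" for i
    proof -
      have "E i \<in> ?A i" using sh_zero[OF E[OF that]] by (metis (mono_tags, lifting) mem_Collect_eq)
      then show ?thesis using extension_closure_superset[OF A[OF that]] sub[OF that] by blast
    qed
    then have "graded_sums C n E \<subseteq> V" by (rule graded_sums_subset[OF V])
    then show "Ob C \<subseteq> V"
      using assms(3) V unfolding generated_by_def triangulated_hull_def by blast
  qed
qed

end
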